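(* Let $\nu>0$, let $D\subset\mathbb{R}^4$ be a bounded domain with nonempty interior, and for $j=1,2$ let $Y_j$ be a mean-zero stationary Matérn Gaussian random field on $\mathbb{R}^4$ with parameters $\sigma_j>0$, $\alpha_j>0$ and common smoothness $\nu$. Assume $$\sigma_1^2\alpha_1^{2\nu}=\sigma_2^2\alpha_2^{2\nu},\qquad \alpha_1\neq\alpha_2 .$$ Let $\mathbf{P}_j$ be the path law of $Y_j$ on $C(\overline D)$. Then $\mathbf{P}_1$ and $\mathbf{P}_2$ are mutually singular on $C(\overline D)$.
   Context: The Matérn field on $\mathbb{R}^4$ with parameters $\sigma,\alpha,\nu>0$ is the real-valued mean-zero stationary Gaussian field with covariance $\mathrm{Cov}(Y(s),Y(t))=K(t-s)$, where $$K(h)=\sigma^2\frac{(\alpha|h|)^\nu}{2^{\nu-1}\Gamma(\nu)}\mathcal{K}_\nu(\alpha|h|)\quad(h\ne0),\qquad K(0)=\sigma^2,$$ $|\cdot|$ is the Euclidean norm and $\mathcal{K}_\nu$ is the modified Bessel function of the second kind. Equivalently, $K(h)=(2\pi)^{-4}\int_{\mathbb{R}^4}e^{i\xi\cdot h}f(\xi)\,d\xi$ with spectral density $f(\xi)=C_\nu\sigma^2\alpha^{2\nu}(\alpha^2+|\xi|^2)^{-(\nu+2)}$, where $C_\nu>0$ depends only on $\nu$. Such a field admits a modification $\widetilde Y_j$ whose sample paths are almost surely continuous on the compact set $\overline D$; the path law $\mathbf{P}_j$ is the law of $\widetilde Y_j$ on $C(\overline D)$, equipped with the uniform norm and its Borel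 $\sigma$-field. *)

theory Defs
  imports "HOL-Probability.Probability"
begin

(* Modified Bessel function of the second kind, by its classical integral representation
   K_nu(x) = \<integral>\<^sub>0\<^sup>\<infinity> exp (- x cosh t) cosh (nu t) dt,
   valid for every real order nu and every x > 0; it is only used for x > 0. *)
definition bessel_K :: "real \<Rightarrow> real \<Rightarrow> real" where
  "bessel_K \<nu> x = (\<integral>t\<in>{0..}. exp (- x * cosh t) * cosh (\<nu> * t) \<partial>lborel)"

definition matern_cov :: "real \<Rightarrow> real \<Rightarrow> real \<Rightarrow> 'a::real_normed_vector \<Rightarrow> real" where
  "matern_cov \<sigma> \<alpha> \<nu> h =
     (if h = 0 then \<sigma>\<^sup>2
      else \<sigma>\<^sup>2 * ((\<alpha> * norm h) powr \<nu> / (2 powr (\<nu> - 1) * Gamma \<nu>)) * bessel_K \<nu> (\<alpha> * norm h))"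

definition covariance :: "'w measure \<Rightarrow> ('w \<Rightarrow> real) \<Rightarrow> ('w \<Rightarrow> real) \<Rightarrow> real" where
  "covariance M X Y =
     (\<integral>\<omega>. (X \<omega> - (\<integral>\<omega>'. X \<omega>' \<partial>M)) * (Y \<omega> - (\<integral>\<omega>'. Y \<omega>' \<partial>M)) \<partial>M)"

(* Point masses are included as normal laws of variance 0. *)
definition gaussian_law :: "real measure \<Rightarrow> bool" where
  "gaussian_law P \<longleftrightarrow>
     (\<exists>m. P = return borel m) \<or> (\<exists>m s. s > 0 \<and> P = density lborel (normal_density m s))"

definition gaussian_field :: "'w measure \<Rightarrow> ('a \<Rightarrow> 'w \<Rightarrow> real) \<Rightarrow> bool" where
  "gaussian_field M Y \<longleftrightarrow>
     prob_space M \<and>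
     (\<forall>t. Y t \<in> borel_measurable M) \<and>
     (\<forall>T c. finite T \<longrightarrow> gaussian_law (distr M borel (\<lambda>\<omega>. \<Sum>t\<in>T. c t * Y t \<omega>)))"

definition stationary_field :: "'w measure \<Rightarrow> ('a::ab_group_add \<Rightarrow> 'w \<Rightarrow> real) \<Rightarrow> bool" where
  "stationary_field M Y \<longleftrightarrow>
     (\<forall>h T. finite T \<longrightarrow>
        distr M (\<Pi>\<^sub>M t\<in>T. borel) (\<lambda>\<omega>. \<lambda>t\<in>T. Y (t + h) \<omega>) =
        distr M (\<Pi>\<^sub>M t\<in>T. borel) (\<lambda>\<omega>. \<lambda>t\<in>T. Y t \<omega>))"

definition matern_field ::
  "'w measure \<Rightarrow> ('a::real_normed_vector \<Rightarrow> 'w \<Rightarrow> real) \<Rightarrow> real \<Rightarrow> real \<Rightarrow> real \<Rightarrow> bool" where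
  "matern_field M Y \<sigma> \<alpha> \<nu> \<longleftrightarrow>
     gaussian_field M Y \<and> stationary_field M Y \<and>
     (\<forall>t. (\<integral>\<omega>. Y t \<omega> \<partial>M) = 0) \<and>
     (\<forall>s t. covariance M (Y s) (Y t) = matern_cov \<sigma> \<alpha> \<nu> (t - s))"

(* C(K) with the uniform metric, for compact K. Its elements are extensional functions, that is,
   they are undefined outside K, so that functions are identified exactly when they agree on K. *)
definition C_space :: "'a::topological_space set \<Rightarrow> ('a \<Rightarrow> real) metric" where
  "C_space K = cfunspace (top_of_set K) euclidean_metric"

definition C_borel :: "'a::topological_space set \<Rightarrow> ('a \<Rightarrow> real) measure" where
  "C_borel K = sigma (mspace (C_space K)) {U. openin (mtopology_of (C_space K)) U}"

definition continuous_modification ::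
  "'w measure \<Rightarrow> ('a::topological_space \<Rightarrow> 'w \<Rightarrow> real) \<Rightarrow> 'a set \<Rightarrow> ('a \<Rightarrow> 'w \<Rightarrow> real) \<Rightarrow> bool" where
  "continuous_modification M Y K Z \<longleftrightarrow>
     (\<forall>t. Z t \<in> borel_measurable M) \<and>
     (\<forall>t. AE \<omega> in M. Z t \<omega> = Y t \<omega>) \<and>
     (AE \<omega> in M. continuous_on K (\<lambda>t. Z t \<omega>))"

(* P is the law on C(K) of a modification Z of Y with almost surely continuous paths on K. The
   paths of Z lie in C(K) only up to a null set, so the law is taken of a random element X of C(K)
   that agrees almost surely with the path of Z; the choice of X on the null set, and of Z, does
   not affect P. *)
definition is_path_law ::
  "'w measure \<Rightarrow> ('a::topological_space \<Rightarrow> 'w \<Rightarrow> real) \<Rightarrow> 'a set \<Rightarrow> ('a \<Rightarrow> real) measure \<Rightarrow> bool" where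
  "is_path_law M Y K P \<longleftrightarrow>
     (\<exists>Z X. continuous_modification M Y K Z \<and>
            X \<in> measurable M (C_borel K) \<and>
            (AE \<omega> in M. X \<omega> = (\<lambda>t\<in>K. Z t \<omega>)) \<and>
            P = distr M (C_borel K) X)"

definition mutually_singular :: "'b measure \<Rightarrow> 'b measure \<Rightarrow> bool" where
  "mutually_singular P Q \<longleftrightarrow>
     (\<exists>A. A \<in> sets P \<and> A \<in> sets Q \<and> emeasure P A = 0 \<and> emeasure Q (space Q - A) = 0)"

end

theory Submission
  imports Defs
begin

text \<open>
  Any two such fields can be told apart by a quadratic statistic of finitely many values of the path.
  The Matern covariance is a mixture of Gaussian kernels,
  \[ K(h) = \kappa \int_0^\infty v^{\nu-1} e^{-\alpha^2 v} e^{-|h|^2/(4v)} \, dv, \qquad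
     \kappa = \sigma^2 \alpha^{2\nu} / \Gamma(\nu) \]
  (\<open>matern_cov_eq_mix\<close>). The hypothesis says that \<open>\<kappa>\<close> is common to the two fields, so that they
  differ only in the factor \<open>exp (- \<alpha>\<^sup>2 v)\<close>, which is \<open>1 + O(v)\<close> at the squared length scale \<open>v\<close>. The
  task is to collect this small relative discrepancy over sufficiently many nearly independent
  functionals of the path.

  The functionals are finite differences of a high order \<open>p\<close>: a stencil of \<open>p + 1\<close> equidistant
  points with spacing \<open>r\<close> in one coordinate direction, placed at the points of a grid of spacing
  \<open>r\<close> in a cube of side \<open>L\<close> whose enlargement lies in the domain. Such a functional has a variance
  of order \<open>r powr (2 * \<nu>)\<close>, and three facts about it carry the proof.

  \<^item> The variances under the two fields differ by at least a constant times \<open>r powr (2 * \<nu> + 2)\<close>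
    (\<open>matern_mix_stencil_gap\<close>); the sign of the difference is the same at all scales because
    Gaussian kernels are positive semidefinite.

  \<^item> The covariances of the functionals of spacing \<open>r\<close> with one fixed value of the field decay away
    from that value, since differences of high order nearly annihilate wide Gaussian kernels, and
    they are square-summable over the grid, uniformly in the number of its points
    (\<open>matern_mix_stencil_bound\<close>). Hence the squared covariances of all functionals of spacing \<open>r\<close>
    with one fixed functional sum to \<open>O(r powr (4 * \<nu>))\<close> (\<open>stencil_covariance_sum_bound\<close>).

  \<^item> The variance of a sum of squares of centered jointly Gaussian variables is twice the sum of
    their squared covariances (\<open>isserlis\<close>, \<open>quadratic_form_deviation\<close>).

  In dimension four a grid has \<open>(L / r)^4\<close> points. Give the squares of the functionals of spacing \<open>r\<close>
  the weight \<open>r powr (2 - 2 * \<nu>)\<close>. Then a single scale \<open>r\<close> contributes a gap of order one to the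
  difference of the two expectations, and also a variance of order one: no single scale suffices, and
  the dimension is exactly critical. For two scales \<open>r' \<le> r\<close> the covariance of the two contributions is at
  most a constant times \<open>(r' / r) powr (2 + 2 * \<nu>)\<close>. Hence over \<open>J\<close> dyadic scales both the gap of the expectations
  (\<open>multiscale_gap\<close>) and the variance (\<open>multiscale_covariance_sum_bound\<close>) are of order \<open>J\<close>,
  and by Chebyshev's inequality the two path laws are separated up to an error \<open>O(1 / J)\<close>. Letting
  \<open>J\<close> grow, Borel-Cantelli yields the singularity.
\<close>

section \<open>Mutual singularity of laws on spaces of continuous functions\<close>

lemma mutually_singular_sym:
  assumes "mutually_singular P Q" "sets P = sets Q"
  shows "mutually_singular Q P"
proof -
  have sp: "space P = space Q" using assms(2) by (rule sets_eq_imp_space_eq)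
  obtain A where A: "A \<in> sets P" "A \<in> sets Q" "emeasure P A = 0" "emeasure Q (space Q - A) = 0"
    using assms(1) unfolding mutually_singular_def by blast
  have "space P - (space Q - A) = A"
    using sets.sets_into_space[OF A(1)] sp by blast
  then show ?thesis
    unfolding mutually_singular_def using A assms(2) sp
    by (intro exI[of _ "space Q - A"]) auto
qed

text \<open>
  Choosing errors \<open>2^(-n)\<close>, the events \<open>A n\<close> have summable probability under \<open>P\<close> and their
  complements have summable probability under \<open>Q\<close>. By Borel-Cantelli \<open>limsup A\<close> is a \<open>P\<close>-null set
  and its complement, which is even contained in the limes superior of the complements, is \<open>Q\<close>-null.
\<close>
lemma mutually_singular_if_separating_events:
  assumes "prob_space P" "prob_space Q" and sets_eq: "sets P = sets Q"
    and sep: "\<And>\<epsilon>. \<epsilon> > 0 \<Longrightarrow> \<exists>A\<in>sets P. measure P A \<le> \<epsilon> \<and> measure Q (space Q - A) \<le> \<epsilon>"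
  shows "mutually_singular P Q"
proof -
  interpret P: prob_space P by fact
  interpret Q: prob_space Q by fact
  have sp: "space P = space Q" using sets_eq by (rule sets_eq_imp_space_eq)
  have "\<forall>n::nat. \<exists>A\<in>sets P. measure P A \<le> (1/2)^n \<and> measure Q (space Q - A) \<le> (1/2)^n"
    by (intro allI sep) simp
  then obtain A where A: "\<And>n. A n \<in> sets P" "\<And>n. measure P (A n) \<le> (1/2)^n"
    "\<And>n. measure Q (space Q - A n) \<le> (1/2)^n" by metis
  have AQ: "A n \<in> sets Q" for n using A(1) sets_eq by simp
  have "summable (\<lambda>n. measure P (A n))" "summable (\<lambda>n. measure Q (space Q - A n))"
    using A(2,3) by (auto intro!: summable_comparison_test'[OF summable_geometric[of "1/2::real"]])
  then have 0: "emeasure P (limsup A) = 0" "emeasure Q (limsup (\<lambda>n. space Q - A n)) = 0"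
    using A(1) AQ by (auto intro!: null_setsD1 borel_cantelli_limsup1 simp: less_top[symmetric])
  have meas: "limsup A \<in> sets Q" "limsup (\<lambda>n. space Q - A n) \<in> sets Q"
    using AQ by (auto intro!: measurable_limsup)
  have "space Q - limsup A \<subseteq> limsup (\<lambda>n. space Q - A n)"
    by (auto simp: limsup_INF_SUP) (metis atLeast_iff le_cases order_refl)+
  then have "emeasure Q (space Q - limsup A) = 0"
    using 0(2) meas(2) by (metis emeasure_eq_0)
  then show ?thesis
    unfolding mutually_singular_def using 0(1) meas sets_eq by auto
qed

text \<open>
  Evaluation at a point is 1-Lipschitz for the uniform metric, so it is continuous.
\<close>
lemma measurable_C_borel_eval:
  fixes K :: "'a::topological_space set"
  assumes "compact K" "t \<in> K"
  shows "(\<lambda>f. f t) \<in> borel_measurable (C_borel K)"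
proof (rule borel_measurableI)
  fix U :: "real set" assume U: "open U"
  interpret C: Metric_space "mspace (C_space K)" "mdist (C_space K)" by (rule Metric_space_mspace_mdist)
  have sp: "space (C_borel K) = mspace (C_space K)"
    unfolding C_borel_def
    by (simp add: space_measure_of_conv)
  have le: "dist (f t) (g t) \<le> mdist (C_space K) f g"
    if "f \<in> mspace (C_space K)" "g \<in> mspace (C_space K)" for f g
    using mdist_cfunspace_imp_mdist_le[of f "top_of_set K" euclidean_metric g "mdist (C_space K) f g" t]
      that assms(2) by (simp add: C_space_def)
  have "openin (mtopology_of (C_space K)) ((\<lambda>f. f t) -` U \<inter> mspace (C_space K))"
    unfolding mtopology_of_def C.openin_mtopology
  proof (intro conjI allI impI)
    fix f assume "f \<in> (\<lambda>f. f t) -` U \<inter> mspace (C_space K)"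
    then have f: "f t \<in> U" "f \<in> mspace (C_space K)" by auto
    then obtain e where e: "e > 0" "ball (f t) e \<subseteq> U" using U openE by blast
    have "C.mball f e \<subseteq> (\<lambda>f. f t) -` U \<inter> mspace (C_space K)"
      using le f e(2) by (auto simp: C.mball_def subset_iff intro: order.strict_trans1)
    then show "\<exists>r>0. C.mball f r \<subseteq> (\<lambda>f. f t) -` U \<inter> mspace (C_space K)" using e(1) by blast
  qed auto
  then show "(\<lambda>f. f t) -` U \<inter> space (C_borel K) \<in> sets (C_borel K)"
    unfolding sp unfolding C_borel_def
    by (subst sets_measure_of) (use openin_subset[of "mtopology_of (C_space K)"] in \<open>auto simp: mtopology_of_def\<close>)
qed

lemma is_path_law_prob_space:
  assumes "prob_space M" "is_path_law M Y K P"
  shows "prob_space P" "sets P = sets (C_borel K)"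
  using assms by (auto simp: is_path_law_def intro: prob_space.prob_space_distr)

text \<open>
  At finitely many points the random path, the continuous modification and the field itself agree
  almost surely. Statistics of finitely many path values can therefore be studied on the
  probability space of the field.
\<close>
lemma is_path_law_finite_dim:
  fixes \<Psi> :: "('a::topological_space \<Rightarrow> real) \<Rightarrow> real"
  assumes P: "is_path_law M Y K P" and "finite T" "T \<subseteq> K" "compact K" and pM: "prob_space M"
    and dep: "\<And>f g. (\<And>t. t \<in> T \<Longrightarrow> f t = g t) \<Longrightarrow> \<Psi> f = \<Psi> g"
    and \<Psi>: "\<Psi> \<in> borel_measurable (C_borel K)"
    and Y: "(\<lambda>\<omega>. \<Psi> (\<lambda>t. Y t \<omega>)) \<in> borel_measurable M"
    and B: "B \<in> sets borel"
  shows "measure P (\<Psi> -` B \<inter> space P) = measure M {\<omega>\<in>space M. \<Psi> (\<lambda>t. Y t \<omega>) \<in> B}"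
proof -
  obtain Z X where Z: "continuous_modification M Y K Z" and X: "X \<in> measurable M (C_borel K)"
    and ae: "AE \<omega> in M. X \<omega> = (\<lambda>t\<in>K. Z t \<omega>)" and PX: "P = distr M (C_borel K) X"
    using P unfolding is_path_law_def by blast
  have "AE \<omega> in M. \<forall>t\<in>T. Z t \<omega> = Y t \<omega>"
    using Z \<open>finite T\<close> by (intro AE_finite_allI) (auto simp: continuous_modification_def)
  with ae have ae2: "AE \<omega> in M. \<Psi> (X \<omega>) = \<Psi> (\<lambda>t. Y t \<omega>)"
    by eventually_elim (use \<open>T \<subseteq> K\<close> in \<open>auto intro!: dep\<close>)
  have "measure P (\<Psi> -` B \<inter> space P) = measure M (X -` (\<Psi> -` B \<inter> space P) \<inter> space M)"
    unfolding PX using X \<Psi> B by (subst measure_distr) auto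
  also have "X -` (\<Psi> -` B \<inter> space P) \<inter> space M = {\<omega>\<in>space M. \<Psi> (X \<omega>) \<in> B}"
    using measurable_space[OF X] by (auto simp: PX)
  also have "measure M \<dots> = measure M {\<omega>\<in>space M. \<Psi> (\<lambda>t. Y t \<omega>) \<in> B}"
  proof (intro measure_eq_AE)
    show "AE x in M. (x \<in> {\<omega> \<in> space M. \<Psi> (X \<omega>) \<in> B}) = (x \<in> {\<omega> \<in> space M. \<Psi> (\<lambda>t. Y t \<omega>) \<in> B})"
      using ae2 by eventually_elim auto
  qed (use measurable_compose[OF X \<Psi>] Y B in measurable)
  finally show ?thesis .
qed

section \<open>Quadratic forms in a centered Gaussian field\<close>

text \<open>
  A degenerate centered normal law is the point mass at 0, and all moments vanish; otherwise the
  second and fourth moments are \<open>s^2\<close> and \<open>3 * s^4\<close>.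
\<close>
lemma centered_gaussian_moments:
  assumes pM: "prob_space M" and X[measurable]: "X \<in> borel_measurable M"
    and g: "gaussian_law (distr M borel X)" and mean: "(\<integral>\<omega>. X \<omega> \<partial>M) = 0"
  shows "integrable M (\<lambda>\<omega>. X \<omega> ^ 2)" "integrable M (\<lambda>\<omega>. X \<omega> ^ 4)"
    "(\<integral>\<omega>. X \<omega> ^ 4 \<partial>M) = 3 * (\<integral>\<omega>. X \<omega> ^ 2 \<partial>M)\<^sup>2" "integrable M X"
proof -
  interpret prob_space M by fact
  have "(integrable M (\<lambda>\<omega>. X \<omega> ^ 2) \<and> integrable M (\<lambda>\<omega>. X \<omega> ^ 4)) \<and>
    (\<integral>\<omega>. X \<omega> ^ 4 \<partial>M) = 3 * (\<integral>\<omega>. X \<omega> ^ 2 \<partial>M)\<^sup>2 \<and> integrable M X"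
    using g unfolding gaussian_law_def
  proof (elim disjE exE conjE)
    fix m assume d: "distr M borel X = return borel m"
    have "AE x in distr M borel X. x = m" unfolding d by (subst AE_return) auto
    then have ae: "AE \<omega> in M. X \<omega> = m" by (subst (asm) AE_distr_iff) auto
    then have "(\<integral>\<omega>. X \<omega> \<partial>M) = (\<integral>\<omega>. m \<partial>M)" by (intro integral_cong_AE) auto
    then have "m = 0" using mean by (simp add: prob_space)
    then have "AE \<omega> in M. X \<omega> = 0" using ae by simp
    then have "AE \<omega> in M. X \<omega> ^ 2 = 0" "AE \<omega> in M. X \<omega> ^ 4 = 0" "AE \<omega> in M. X \<omega> = 0" by auto
    then have *: "integrable M (\<lambda>\<omega>. X \<omega> ^ 2) = integrable M (\<lambda>\<omega>. 0::real)"
       "integrable M (\<lambda>\<omega>. X \<omega> ^ 4) = integrable M (\<lambda>\<omega>. 0::real)"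
       "integrable M X = integrable M (\<lambda>\<omega>. 0::real)"
       "(\<integral>\<omega>. X \<omega> ^ 4 \<partial>M) = (\<integral>\<omega>. 0 \<partial>M)"
       "(\<integral>\<omega>. X \<omega> ^ 2 \<partial>M) = (\<integral>\<omega>. 0 \<partial>M)"
      by - (rule integrable_cong_AE integral_cong_AE; simp)+
    show ?thesis unfolding * by simp
  next
    fix m s :: real assume s: "s > 0" and d: "distr M borel X = density lborel (normal_density m s)"
    have "has_bochner_integral (distr M borel X) (\<lambda>x. x) m"
      unfolding d using normal_moment_nz_1[OF s, of m]
      by (subst has_bochner_integral_density) (auto simp: normal_density_nonneg)
    then have iX: "has_bochner_integral M X m"
      by (simp add: has_bochner_integral_iff integrable_distr_eq integral_distr)
    then have m: "m = 0" using mean by (auto dest: has_bochner_integral_integral_eq)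
    have mom: "has_bochner_integral M (\<lambda>\<omega>. X \<omega> ^ (2*k)) (fact (2*k) / ((2 / s\<^sup>2)^k * fact k))" for k
    proof -
      have "has_bochner_integral (distr M borel X) (\<lambda>x. x ^ (2*k)) (fact (2*k) / ((2 / s\<^sup>2)^k * fact k))"
        unfolding d using normal_moment_even[OF s, of m k] m
        by (subst has_bochner_integral_density) (auto simp: normal_density_nonneg)
      then show ?thesis by (simp add: has_bochner_integral_iff integrable_distr_eq integral_distr)
    qed
    from mom[of 1] mom[of 2] iX s show ?thesis
      by (auto simp: has_bochner_integral_iff fact_numeral power2_eq_square field_simps)
  qed
  then show "integrable M (\<lambda>\<omega>. X \<omega> ^ 2)" "integrable M (\<lambda>\<omega>. X \<omega> ^ 4)"
    "(\<integral>\<omega>. X \<omega> ^ 4 \<partial>M) = 3 * (\<integral>\<omega>. X \<omega> ^ 2 \<partial>M)\<^sup>2" "integrable M X" by auto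
qed

text \<open>
  The linear combinations of values of the field are exactly the variables that
  \<^const>\<open>gaussian_field\<close> declares to be normal. Being closed under sums, the span also provides
  joint normality.
\<close>
definition field_span :: "('a \<Rightarrow> 'w \<Rightarrow> real) \<Rightarrow> ('w \<Rightarrow> real) set" where
  "field_span Y = {X. \<exists>T c. finite T \<and> X = (\<lambda>\<omega>. \<Sum>t\<in>T. c t * Y t \<omega>)}"

lemma field_span_base: "Y t \<in> field_span Y"
  unfolding field_span_def by (auto intro!: exI[of _ "{t}"] exI[of _ "\<lambda>_. 1"])

lemma field_span_scale: "X \<in> field_span Y \<Longrightarrow> (\<lambda>\<omega>. a * X \<omega>) \<in> field_span Y"
  unfolding field_span_def by (force simp: sum_distrib_left mult.assoc[symmetric])

lemma field_span_add:
  assumes "X1 \<in> field_span Y" "X2 \<in> field_span Y"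
  shows "(\<lambda>\<omega>. X1 \<omega> + X2 \<omega>) \<in> field_span Y"
proof -
  obtain T1 c1 T2 c2 where X: "finite T1" "X1 = (\<lambda>\<omega>. \<Sum>t\<in>T1. c1 t * Y t \<omega>)"
    "finite T2" "X2 = (\<lambda>\<omega>. \<Sum>t\<in>T2. c2 t * Y t \<omega>)"
    using assms unfolding field_span_def by blast
  define c where "c t = (if t \<in> T1 then c1 t else 0) + (if t \<in> T2 then c2 t else 0)" for t
  have "(\<Sum>t\<in>T1\<union>T2. c t * Y t \<omega>) = X1 \<omega> + X2 \<omega>" for \<omega>
  proof -
    have "(\<Sum>t\<in>T1\<union>T2. (if t \<in> S then d t else 0) * Y t \<omega>) = (\<Sum>t\<in>S. d t * Y t \<omega>)"
      if "S \<subseteq> T1 \<union> T2" for S d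
      using that X(1,3) by (intro sum.mono_neutral_cong_right) auto
    then show ?thesis by (simp add: c_def distrib_right sum.distrib X(2,4))
  qed
  then show ?thesis
    unfolding field_span_def using X(1,3) by (auto intro!: exI[of _ "T1 \<union> T2"] exI[of _ c])
qed

lemma field_span_0: "(\<lambda>\<omega>. 0) \<in> field_span Y"
  unfolding field_span_def by (auto intro!: exI[of _ "{}"])

lemma field_span_sum:
  "(\<And>i. i \<in> I \<Longrightarrow> X i \<in> field_span Y) \<Longrightarrow> (\<lambda>\<omega>. \<Sum>i\<in>I. X i \<omega>) \<in> field_span Y"
  by (induction I rule: infinite_finite_induct) (auto intro: field_span_add field_span_0)

locale centered_gaussian_field =
  fixes M :: "'w measure" and Y :: "'a \<Rightarrow> 'w \<Rightarrow> real"
  assumes gaussian: "gaussian_field M Y" and centered: "\<And>t. (\<integral>\<omega>. Y t \<omega> \<partial>M) = 0"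
begin

sublocale prob_space M using gaussian by (simp add: gaussian_field_def)

lemma span_gaussian:
  assumes "X \<in> field_span Y"
  shows "X \<in> borel_measurable M" "gaussian_law (distr M borel X)"
  using assms gaussian unfolding field_span_def gaussian_field_def
  by (auto intro!: borel_measurable_sum borel_measurable_times)

lemma Y_integrable: "integrable M (Y t)"
  by (intro centered_gaussian_moments prob_space_axioms span_gaussian field_span_base centered)

lemma span_centered: "X \<in> field_span Y \<Longrightarrow> (\<integral>\<omega>. X \<omega> \<partial>M) = 0"
  unfolding field_span_def by (auto simp: Bochner_Integration.integral_sum Y_integrable centered)

lemma span_moments:
  assumes "X \<in> field_span Y"
  shows "integrable M (\<lambda>\<omega>. X \<omega> ^ 2)" "integrable M (\<lambda>\<omega>. X \<omega> ^ 4)"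
    "(\<integral>\<omega>. X \<omega> ^ 4 \<partial>M) = 3 * (\<integral>\<omega>. X \<omega> ^ 2 \<partial>M)\<^sup>2" "integrable M X"
  using centered_gaussian_moments[OF prob_space_axioms span_gaussian[OF assms] span_centered[OF assms]]
  by auto

lemma span_minus: "X \<in> field_span Y \<Longrightarrow> Z \<in> field_span Y \<Longrightarrow> (\<lambda>\<omega>. X \<omega> - Z \<omega>) \<in> field_span Y"
  using field_span_add[OF _ field_span_scale[of Z Y "-1"], of X] by simp

lemma span_product_integrable:
  assumes "X \<in> field_span Y" "Z \<in> field_span Y"
  shows "integrable M (\<lambda>\<omega>. X \<omega> * Z \<omega>)"
proof -
  have "integrable M (\<lambda>\<omega>. ((X \<omega> + Z \<omega>)^2 - (X \<omega> - Z \<omega>)^2) / 4)"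
    using span_moments(1)[OF field_span_add[OF assms]] span_moments(1)[OF span_minus[OF assms]] by simp
  then show ?thesis by (simp add: power2_eq_square algebra_simps)
qed

text \<open>
  The special case of the Wick-Isserlis formula that determines variances of quadratic forms. By
  polarisation \<open>X^2 * Z^2\<close> is a combination of fourth powers of \<open>X + Z\<close>, \<open>X - Z\<close>, \<open>X\<close> and \<open>Z\<close>,
  which are all centered normal, so that each fourth moment is three times a squared variance.
\<close>
lemma isserlis:
  assumes "X \<in> field_span Y" "Z \<in> field_span Y"
  shows "integrable M (\<lambda>\<omega>. (X \<omega>)\<^sup>2 * (Z \<omega>)\<^sup>2)"
    and "(\<integral>\<omega>. (X \<omega>)\<^sup>2 * (Z \<omega>)\<^sup>2 \<partial>M) =
      (\<integral>\<omega>. (X \<omega>)\<^sup>2 \<partial>M) * (\<integral>\<omega>. (Z \<omega>)\<^sup>2 \<partial>M) + 2 * (\<integral>\<omega>. X \<omega> * Z \<omega> \<partial>M)\<^sup>2"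
proof -
  note mX = span_moments[OF assms(1)] and mZ = span_moments[OF assms(2)]
    and mp = span_moments[OF field_span_add[OF assms]] and mm = span_moments[OF span_minus[OF assms]]
    and XZ = span_product_integrable[OF assms]
  have id: "(X \<omega>)\<^sup>2 * (Z \<omega>)\<^sup>2 = ((X \<omega> + Z \<omega>)^4 + (X \<omega> - Z \<omega>)^4 - 2 * X \<omega> ^ 4 - 2 * Z \<omega> ^ 4) / 12" for \<omega>
    by (simp add: power2_eq_square power4_eq_xxxx algebra_simps)
  show "integrable M (\<lambda>\<omega>. (X \<omega>)\<^sup>2 * (Z \<omega>)\<^sup>2)"
    unfolding id using mX mZ mp mm by auto
  have sq: "(\<integral>\<omega>. (X \<omega> + Z \<omega>)\<^sup>2 \<partial>M) = (\<integral>\<omega>. (X \<omega>)\<^sup>2 \<partial>M) + (\<integral>\<omega>. (Z \<omega>)\<^sup>2 \<partial>M) + 2 * (\<integral>\<omega>. X \<omega> * Z \<omega> \<partial>M)"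
    "(\<integral>\<omega>. (X \<omega> - Z \<omega>)\<^sup>2 \<partial>M) = (\<integral>\<omega>. (X \<omega>)\<^sup>2 \<partial>M) + (\<integral>\<omega>. (Z \<omega>)\<^sup>2 \<partial>M) - 2 * (\<integral>\<omega>. X \<omega> * Z \<omega> \<partial>M)"
    using mX mZ XZ by (simp_all add: power2_sum power2_diff mult.assoc)
  have "(\<integral>\<omega>. (X \<omega>)\<^sup>2 * (Z \<omega>)\<^sup>2 \<partial>M) =
    (3 * (\<integral>\<omega>. (X \<omega> + Z \<omega>)\<^sup>2 \<partial>M)\<^sup>2 + 3 * (\<integral>\<omega>. (X \<omega> - Z \<omega>)\<^sup>2 \<partial>M)\<^sup>2
     - 2 * (3 * (\<integral>\<omega>. (X \<omega>)\<^sup>2 \<partial>M)\<^sup>2) - 2 * (3 * (\<integral>\<omega>. (Z \<omega>)\<^sup>2 \<partial>M)\<^sup>2)) / 12"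
    unfolding id using mX mZ mp mm by simp
  then show "(\<integral>\<omega>. (X \<omega>)\<^sup>2 * (Z \<omega>)\<^sup>2 \<partial>M) =
      (\<integral>\<omega>. (X \<omega>)\<^sup>2 \<partial>M) * (\<integral>\<omega>. (Z \<omega>)\<^sup>2 \<partial>M) + 2 * (\<integral>\<omega>. X \<omega> * Z \<omega> \<partial>M)\<^sup>2"
    unfolding sq by (simp add: power2_eq_square algebra_simps)
qed

text \<open>
  Chebyshev's inequality; by \<open>isserlis\<close> the variance of the quadratic form is twice the double
  sum on the right.
\<close>
lemma quadratic_form_deviation:
  fixes w :: "'i \<Rightarrow> real"
  assumes "finite I" "\<And>i. i \<in> I \<Longrightarrow> L i \<in> field_span Y" "\<epsilon> > 0"
  shows "prob {\<omega>\<in>space M. \<bar>(\<Sum>i\<in>I. w i * (L i \<omega>)\<^sup>2) - (\<Sum>i\<in>I. w i * (\<integral>\<omega>. (L i \<omega>)\<^sup>2 \<partial>M))\<bar> \<ge> \<epsilon>} \<le>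
    2 * (\<Sum>i\<in>I. \<Sum>j\<in>I. w i * w j * (\<integral>\<omega>. L i \<omega> * L j \<omega> \<partial>M)\<^sup>2) / \<epsilon>\<^sup>2"
proof -
  define Q where "Q = (\<lambda>\<omega>. \<Sum>i\<in>I. w i * (L i \<omega>)\<^sup>2)"
  have Q2: "(Q \<omega>)\<^sup>2 = (\<Sum>i\<in>I. \<Sum>j\<in>I. w i * w j * ((L i \<omega>)\<^sup>2 * (L j \<omega>)\<^sup>2))" for \<omega>
    unfolding Q_def power2_eq_square sum_product by (simp add: mult_ac)
  have intQ: "integrable M Q" "integrable M (\<lambda>\<omega>. (Q \<omega>)\<^sup>2)"
    unfolding Q2 using assms(2) unfolding Q_def
    by (intro Bochner_Integration.integrable_sum integrable_mult_right span_moments(1) isserlis; simp)+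
  have EQ: "expectation Q = (\<Sum>i\<in>I. w i * (\<integral>\<omega>. (L i \<omega>)\<^sup>2 \<partial>M))"
    unfolding Q_def using assms(2) by (subst Bochner_Integration.integral_sum) (auto intro!: span_moments(1) integrable_mult_right)
  have "expectation (\<lambda>\<omega>. (Q \<omega>)\<^sup>2) = (\<Sum>i\<in>I. \<Sum>j\<in>I. w i * w j * (\<integral>\<omega>. (L i \<omega>)\<^sup>2 * (L j \<omega>)\<^sup>2 \<partial>M))"
    unfolding Q2 using assms(2)
    by (simp add: Bochner_Integration.integral_sum integrable_mult_right isserlis(1))
  also have "\<dots> = (\<Sum>i\<in>I. \<Sum>j\<in>I. w i * w j * ((\<integral>\<omega>. (L i \<omega>)\<^sup>2 \<partial>M) * (\<integral>\<omega>. (L j \<omega>)\<^sup>2 \<partial>M)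
      + 2 * (\<integral>\<omega>. L i \<omega> * L j \<omega> \<partial>M)\<^sup>2))"
    using assms(2) by (intro sum.cong refl) (simp add: isserlis)
  also have "\<dots> = (expectation Q)\<^sup>2 + 2 * (\<Sum>i\<in>I. \<Sum>j\<in>I. w i * w j * (\<integral>\<omega>. L i \<omega> * L j \<omega> \<partial>M)\<^sup>2)"
    unfolding EQ power2_eq_square sum_product
    by (simp add: sum.distrib sum_distrib_left algebra_simps)
  finally have "variance Q = 2 * (\<Sum>i\<in>I. \<Sum>j\<in>I. w i * w j * (\<integral>\<omega>. L i \<omega> * L j \<omega> \<partial>M)\<^sup>2)"
    by (subst variance_eq[OF intQ]) simp
  with Chebyshev_inequality[of Q \<epsilon>] intQ \<open>\<epsilon> > 0\<close> EQ show ?thesis by (auto simp: Q_def)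
qed

lemma covariance_eq: "covariance M (Y s) (Y t) = (\<integral>\<omega>. Y s \<omega> * Y t \<omega> \<partial>M)"
  by (simp add: covariance_def centered)

lemma stencil_in_span: "(\<lambda>\<omega>. \<Sum>k\<le>p. a k * Y (s k) \<omega>) \<in> field_span Y"
  by (intro field_span_sum field_span_scale field_span_base)

lemma stencil_product_expectation:
  "(\<integral>\<omega>. (\<Sum>k\<le>p. a k * Y (s k) \<omega>) * (\<Sum>l\<le>q. b l * Y (t l) \<omega>) \<partial>M) =
    (\<Sum>k\<le>p. \<Sum>l\<le>q. a k * b l * (\<integral>\<omega>. Y (s k) \<omega> * Y (t l) \<omega> \<partial>M))"
proof -
  have int: "integrable M (\<lambda>\<omega>. Y s \<omega> * Y t \<omega>)" for s t
    by (intro span_product_integrable field_span_base)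
  have "(\<Sum>k\<le>p. a k * Y (s k) \<omega>) * (\<Sum>l\<le>q. b l * Y (t l) \<omega>) =
      (\<Sum>k\<le>p. \<Sum>l\<le>q. a k * b l * (Y (s k) \<omega> * Y (t l) \<omega>))" for \<omega>
    unfolding sum_product by (intro sum.cong refl) simp
  then show ?thesis using int by (simp add: Bochner_Integration.integral_sum)
qed

end

section \<open>The Matern covariance as a mixture of Gaussian kernels\<close>

text \<open>
  The Gamma integral, rescaled by \<open>A\<close>.
\<close>
lemma has_bochner_integral_Gamma_kernel:
  fixes \<nu> A :: real
  assumes "\<nu> > 0" "A > 0"
  shows "has_bochner_integral lborel (\<lambda>v. indicator {0<..} v * (v powr (\<nu> - 1) * exp (- (A * v))))
    (Gamma \<nu> / A powr \<nu>)"
proof -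
  define G where "G v = indicator {0<..} v * (v powr (\<nu> - 1) * exp (- v))" for v :: real
  have [measurable]: "G \<in> borel_measurable borel" unfolding G_def by measurable
  have "(\<integral>\<^sup>+ v. ennreal (G v) \<partial>lborel) = (\<integral>\<^sup>+ t. ennreal (indicator {0..} t * t powr (\<nu> - 1) / exp t) \<partial>lborel)"
    unfolding G_def by (intro nn_integral_cong) (auto simp: indicator_def exp_minus field_simps)
  also have "\<dots> = ennreal (Gamma \<nu>)"
    using Gamma_conv_nn_integral_real[of \<nu>] assms by simp
  finally have "has_bochner_integral lborel G (Gamma \<nu>)"
    using Gamma_real_pos[OF assms(1)]
    by (intro has_bochner_integral_nn_integral) (auto simp: G_def)
  then have "has_bochner_integral lborel (\<lambda>v. G (0 + A * v)) (Gamma \<nu> /\<^sub>R \<bar>A\<bar>)"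
    using assms(2) by (subst (asm) lborel_has_bochner_integral_real_affine_iff[where c=A and t=0]) auto
  then have "has_bochner_integral lborel (\<lambda>v. A powr (1 - \<nu>) * G (0 + A * v))
      (A powr (1 - \<nu>) * (Gamma \<nu> /\<^sub>R \<bar>A\<bar>))"
    by (rule has_bochner_integral_mult_right)
  also have "A powr (1 - \<nu>) * (Gamma \<nu> /\<^sub>R \<bar>A\<bar>) = Gamma \<nu> / A powr \<nu>"
    using assms by (simp add: powr_diff field_simps)
  also have "(\<lambda>v. A powr (1 - \<nu>) * G (0 + A * v)) = (\<lambda>v. indicator {0<..} v * (v powr (\<nu> - 1) * exp (- (A * v))))"
    using assms by (auto simp: G_def fun_eq_iff indicator_def zero_less_mult_iff powr_mult powr_diff field_simps)
  finally show ?thesis .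
qed

text \<open>
  The variable \<open>v\<close> is a squared length scale, \<open>s\<close> the squared distance and \<open>A\<close> the squared
  inverse range \<open>\<alpha>^2\<close>. The range enters through \<open>exp (- (A * v))\<close> only, which is close to 1 at
  small scales. The indicator makes this an integral over the whole line, to which affine
  substitutions apply.
\<close>
definition matern_mix :: "real \<Rightarrow> real \<Rightarrow> real \<Rightarrow> real" where
  "matern_mix \<nu> A s =
     (\<integral>v. indicator {0<..} v * (v powr (\<nu> - 1) * exp (- (A * v)) * exp (- (s / (4 * v)))) \<partial>lborel)"

lemma integrable_matern_mix:
  fixes \<nu> A s :: real
  assumes "\<nu> > 0" "A > 0" "s \<ge> 0"
  shows "integrable lborel (\<lambda>v. indicator {0<..} v * (v powr (\<nu> - 1) * exp (- (A * v)) * exp (- (s / (4 * v)))))"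
proof (rule Bochner_Integration.integrable_bound)
  show "integrable lborel (\<lambda>v. indicator {0<..} v * (v powr (\<nu> - 1) * exp (- (A * v))))"
    using has_bochner_integral_Gamma_kernel[OF assms(1,2)] by (simp add: has_bochner_integral_iff)
qed (use assms in \<open>auto simp: indicator_def intro!: mult_left_le AE_I2\<close>)

text \<open>
  Symmetrising under \<open>t \<mapsto> - t\<close> turns \<open>exp (\<nu> * t)\<close> into \<open>cosh (\<nu> * t)\<close>.
\<close>
lemma bessel_K_integral_UNIV:
  assumes "integrable lborel (\<lambda>t. exp (\<nu> * t) * exp (- x * cosh t))"
  shows "(\<integral>t. exp (\<nu> * t) * exp (- x * cosh t) \<partial>lborel) = 2 * bessel_K \<nu> x"
proof -
  let ?f = "\<lambda>t. exp (\<nu> * t) * exp (- x * cosh t)"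
  let ?g = "\<lambda>t. exp (- x * cosh t) * cosh (\<nu> * t)"
  have im: "integrable lborel (\<lambda>t. ?f (- t))"
    using lborel_integrable_real_affine[OF assms, of "-1" 0] by simp
  have eq: "?g t = (?f t + ?f (- t)) / 2" for t
    by (simp add: cosh_def exp_minus field_simps)
  have ig: "integrable lborel ?g" unfolding eq using assms im by simp
  have "(\<integral>t. ?f (- t) \<partial>lborel) = (\<integral>t. ?f t \<partial>lborel)"
    using lborel_integral_real_affine[of "-1" ?f 0] by simp
  then have 1: "(\<integral>t. ?g t \<partial>lborel) = (\<integral>t. ?f t \<partial>lborel)"
    unfolding eq using assms im by simp
  have "integrable lborel (\<lambda>t. indicator {0..} t *\<^sub>R ?g t)"
    using ig by (rule integrable_mult_indicator[rotated]) simp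
  then have "has_bochner_integral lborel (\<lambda>t. indicator {0..} t *\<^sub>R ?g t) (bessel_K \<nu> x)"
    by (simp add: has_bochner_integral_iff bessel_K_def set_lebesgue_integral_def)
  then have "has_bochner_integral lborel ?g (2 *\<^sub>R bessel_K \<nu> x)"
    by (rule has_bochner_integral_even_function) auto
  then show ?thesis using 1 by (auto dest: has_bochner_integral_integral_eq)
qed

text \<open>
  The substitution \<open>v = d / (2 * \<alpha>) * exp t\<close> balances the two exponents: it turns
  \<open>\<alpha>^2 * v + d^2 / (4 * v)\<close> into \<open>\<alpha> * d * cosh t\<close>.
\<close>
lemma matern_mix_eq_bessel_K:
  assumes "\<nu> > 0" "\<alpha> > 0" "d > 0"
  shows "matern_mix \<nu> (\<alpha>\<^sup>2) (d\<^sup>2) = 2 * (d / (2 * \<alpha>)) powr \<nu> * bessel_K \<nu> (\<alpha> * d)"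
proof -
  define b where "b = d / (2 * \<alpha>)"
  have b: "b > 0" using assms by (simp add: b_def)
  define f where "f v = v powr (\<nu> - 1) * exp (- (\<alpha>\<^sup>2 * v)) * exp (- (d\<^sup>2 / (4 * v)))" for v
  define g where "g t = exp (\<nu> * t) * exp (- (\<alpha> * d) * cosh t)" for t
  have range: "(\<lambda>t. b * exp t) ` UNIV = {0<..}"
  proof (intro equalityI subsetI)
    fix v :: real assume "v \<in> {0<..}"
    then have "v = b * exp (ln (v / b))" using b by simp
    then show "v \<in> (\<lambda>t. b * exp t) ` UNIV" by blast
  qed (use b in auto)
  have sub: "\<bar>b * exp t\<bar> * f (b * exp t) = b powr \<nu> * g t" for t
  proof -
    have "\<alpha>\<^sup>2 * (b * exp t) + d\<^sup>2 / (4 * (b * exp t)) = \<alpha> * d * cosh t"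
      using assms by (simp add: b_def cosh_def exp_minus field_simps power2_eq_square)
    then have e: "exp (- (\<alpha>\<^sup>2 * (b * exp t))) * exp (- (d\<^sup>2 / (4 * (b * exp t)))) = exp (- (\<alpha> * d) * cosh t)"
      by (simp flip: exp_add)
    have "b * exp t * (b * exp t) powr (\<nu> - 1) = (b * exp t) powr \<nu>"
      using b by (simp add: powr_diff)
    also have "\<dots> = b powr \<nu> * exp (\<nu> * t)"
      using b by (simp add: powr_def ln_mult distrib_left exp_add mult.commute)
    finally have p: "b * exp t * (b * exp t) powr (\<nu> - 1) = b powr \<nu> * exp (\<nu> * t)" .
    have "\<bar>b * exp t\<bar> * f (b * exp t) = (b * exp t * (b * exp t) powr (\<nu> - 1)) *
       (exp (- (\<alpha>\<^sup>2 * (b * exp t))) * exp (- (d\<^sup>2 / (4 * (b * exp t)))))"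
      using b by (simp add: f_def)
    then show ?thesis unfolding e p g_def by simp
  qed
  have int: "integrable lborel (\<lambda>v. indicator {0<..} v * f v)"
    unfolding f_def by (rule integrable_matern_mix) (use assms in auto)
  then have "set_integrable lebesgue {0<..} f"
    unfolding set_integrable_def by (simp add: integrable_completion)
  then have f: "f absolutely_integrable_on ((\<lambda>t. b * exp t) ` UNIV)" unfolding range .
  have chg: "(\<lambda>t. \<bar>b * exp t\<bar> * f (b * exp t)) absolutely_integrable_on UNIV \<and>
     integral UNIV (\<lambda>t. \<bar>b * exp t\<bar> * f (b * exp t)) = integral {0<..} f"
    using f b unfolding range[symmetric]
    by (subst has_absolute_integral_change_of_variables_1')
       (auto intro!: derivative_eq_intros inj_onI)
  then have ag: "(\<lambda>t. b powr \<nu> * g t) absolutely_integrable_on UNIV"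
    and ig: "integral UNIV (\<lambda>t. b powr \<nu> * g t) = integral {0<..} f" unfolding sub by auto
  have [measurable]: "g \<in> borel_measurable borel"
    unfolding g_def by (intro borel_measurable_continuous_onI continuous_intros)
  have "integrable lebesgue (\<lambda>t. b powr \<nu> * g t)"
    using ag by (simp add: set_integrable_def)
  then have ig': "integrable lborel (\<lambda>t. b powr \<nu> * g t)" by (subst (asm) integrable_completion) auto
  then have gi: "integrable lborel g" using b by simp
  have "matern_mix \<nu> (\<alpha>\<^sup>2) (d\<^sup>2) = (LINT v:{0<..}|lborel. f v)"
    by (simp add: matern_mix_def f_def set_lebesgue_integral_def)
  also have "\<dots> = integral {0<..} f"
    using int by (intro set_borel_integral_eq_integral) (simp add: set_integrable_def)
  also have "\<dots> = integral UNIV (\<lambda>t. b powr \<nu> * g t)" by (rule ig[symmetric])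
  also have "\<dots> = (LINT t:UNIV|lborel. b powr \<nu> * g t)"
    using ig' by (intro set_borel_integral_eq_integral(2)[symmetric]) (simp add: set_integrable_def)
  also have "\<dots> = b powr \<nu> * (2 * bessel_K \<nu> (\<alpha> * d))"
    using bessel_K_integral_UNIV[of \<nu> "\<alpha> * d"] gi
    unfolding g_def by (simp add: set_lebesgue_integral_def)
  finally show ?thesis by (simp add: b_def)
qed

text \<open>
  The prefactor is, up to \<open>Gamma \<nu>\<close>, the quantity \<open>\<sigma>^2 * \<alpha> powr (2 * \<nu>)\<close> on which the two fields
  agree. This is what makes the mixture representation suitable for comparing them.
\<close>
lemma matern_cov_eq_mix:
  assumes "\<nu> > 0" "\<alpha> > 0" "\<sigma> > 0"
  shows "matern_cov \<sigma> \<alpha> \<nu> h = \<sigma>\<^sup>2 * \<alpha> powr (2 * \<nu>) / Gamma \<nu> * matern_mix \<nu> (\<alpha>\<^sup>2) ((norm h)\<^sup>2)"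
proof (cases "h = 0")
  case True
  have "matern_mix \<nu> (\<alpha>\<^sup>2) 0 = Gamma \<nu> / (\<alpha>\<^sup>2) powr \<nu>"
    using has_bochner_integral_Gamma_kernel[of \<nu> "\<alpha>\<^sup>2"] assms
    by (auto simp: matern_mix_def dest: has_bochner_integral_integral_eq)
  moreover have "(\<alpha>\<^sup>2) powr \<nu> = \<alpha> powr (2 * \<nu>)"
    using assms by (simp add: powr_powr flip: powr_numeral)
  ultimately show ?thesis
    using True assms Gamma_real_pos[of \<nu>] by (simp add: matern_cov_def order_less_imp_not_eq2)
next
  case False
  have "\<alpha> powr (2 * \<nu>) = \<alpha> powr \<nu> * \<alpha> powr \<nu>" by (simp flip: powr_add)
  moreover have "matern_mix \<nu> (\<alpha>\<^sup>2) ((norm h)\<^sup>2) =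
      2 * (norm h powr \<nu> / (2 powr \<nu> * \<alpha> powr \<nu>)) * bessel_K \<nu> (\<alpha> * norm h)"
    using False assms matern_mix_eq_bessel_K[of \<nu> \<alpha> "norm h"] by (simp add: powr_mult powr_divide)
  ultimately show ?thesis
    using False assms Gamma_real_pos[of \<nu>]
    by (simp add: matern_cov_def powr_mult powr_diff mult_ac)
qed

section \<open>Finite differences of Gaussian kernels\<close>

text \<open>
  The coefficients are those of the \<open>p\<close>-fold forward difference, and the bound is the mean value
  theorem applied \<open>p\<close> times. Later arguments use only this bound and \<open>a 0 \<noteq> 0\<close>, so the binomial
  coefficients are left implicit. The sequence \<open>D\<close> lists a function and its successive derivatives.
\<close>
lemma difference_stencil_exists:
  "\<exists>a::nat \<Rightarrow> real. a 0 \<noteq> 0 \<and>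
     (\<forall>D x B. (\<forall>n y. (D n has_real_derivative D (Suc n) y) (at y)) \<longrightarrow>
        (\<forall>y\<in>{x..x + real p}. \<bar>D p y\<bar> \<le> B) \<longrightarrow>
        \<bar>\<Sum>k\<le>p. a k * D 0 (x + real k)\<bar> \<le> B)"
proof (induction p)
  case 0
  then show ?case by (intro exI[of _ "\<lambda>_. 1"]) auto
next
  case (Suc p)
  then obtain a :: "nat \<Rightarrow> real" where a0: "a 0 \<noteq> 0" and
    a: "\<And>D x B. (\<And>n y. (D n has_real_derivative D (Suc n) y) (at y)) \<Longrightarrow>
        (\<And>y. y \<in> {x..x + real p} \<Longrightarrow> \<bar>D p y\<bar> \<le> B) \<Longrightarrow>
        \<bar>\<Sum>k\<le>p. a k * D 0 (x + real k)\<bar> \<le> B" by blast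
  \<comment> \<open>one more forward difference: shift by one step, minus the identity\<close>
  define a' where "a' k = (if k = 0 then 0 else a (k - 1)) - (if k \<le> p then a k else 0)" for k
  have "\<bar>\<Sum>k\<le>Suc p. a' k * D 0 (x + real k)\<bar> \<le> B"
    if D: "\<And>n y. (D n has_real_derivative D (Suc n) y) (at y)"
      and B: "\<And>y. y \<in> {x..x + real (Suc p)} \<Longrightarrow> \<bar>D (Suc p) y\<bar> \<le> B" for D x B
  proof -
    define F where "F y = (\<Sum>k\<le>p. a k * D 0 (y + real k))" for y
    have dF: "(F has_real_derivative (\<Sum>k\<le>p. a k * D 1 (y + real k))) (at y)" for y
    proof -
      have "((\<lambda>y. D 0 (y + real k)) has_real_derivative D 1 (y + real k)) (at y)" for k
        using DERIV_shift[of "D 0" "D 1 (y + real k)" y "real k"] D[of 0 "y + real k"] by simp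
      then show ?thesis unfolding F_def by (auto intro!: DERIV_sum DERIV_cmult)
    qed
    obtain \<xi> where \<xi>: "x < \<xi>" "\<xi> < x + 1" "F (x + 1) - F x = (\<Sum>k\<le>p. a k * D 1 (\<xi> + real k))"
      using MVT2[of x "x + 1" F, OF _ dF] by auto
    have "\<bar>\<Sum>k\<le>p. a k * D 1 (\<xi> + real k)\<bar> \<le> B"
      using a[of "\<lambda>n. D (Suc n)" \<xi> B] D B \<xi>(1,2) by auto
    moreover have "(\<Sum>k\<le>Suc p. a' k * D 0 (x + real k)) = F (x + 1) - F x"
    proof -
      have "(\<Sum>k\<le>Suc p. (if k = 0 then 0 else a (k - 1)) * D 0 (x + real k)) = F (x + 1)"
        unfolding sum.atMost_Suc_shift by (simp add: F_def add_ac)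
      moreover have "(\<Sum>k\<le>Suc p. (if k \<le> p then a k else 0) * D 0 (x + real k)) = F x"
        by (simp add: F_def)
      ultimately show ?thesis by (simp only: a'_def left_diff_distrib sum_subtractf)
    qed
    ultimately show ?thesis using \<xi>(3) by simp
  qed
  moreover have "a' 0 \<noteq> 0" using a0 by (simp add: a'_def)
  ultimately show ?case by (intro exI[of _ a']) blast
qed

text \<open>
  Up to scaling, the Hermite polynomials: the \<open>n\<close>-th derivative of \<open>exp (- (y^2 / 4))\<close> is
  \<open>poly (hermite_poly n) y * exp (- (y^2 / 4))\<close>.
\<close>
primrec hermite_poly :: "nat \<Rightarrow> real poly" where
  "hermite_poly 0 = 1"
| "hermite_poly (Suc n) = pderiv (hermite_poly n) - [:0, 1/2:] * hermite_poly n"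

lemma power_over_fact_le_exp:
  fixes x :: real
  assumes "x \<ge> 0"
  shows "x ^ n / fact n \<le> exp x"
proof -
  have "(\<Sum>k\<in>{n}. x ^ k /\<^sub>R fact k) \<le> exp x"
    unfolding exp_def using assms by (intro sum_le_suminf summable_exp_generic) auto
  then show ?thesis by (simp add: divide_inverse_commute)
qed

text \<open>
  With the rate \<open>1/8\<close>, half of the decay \<open>exp (- (z^2 / 4))\<close> absorbs any polynomial and the other
  half is left.
\<close>
lemma poly_le_exp_square:
  fixes P :: "real poly"
  shows "\<exists>C>0. \<forall>z. \<bar>poly P z\<bar> \<le> C * exp (z\<^sup>2 / 8)"
proof -
  have pw: "\<bar>z ^ n\<bar> \<le> (1 + 8 ^ n * fact n) * exp (z\<^sup>2 / 8)" for z :: real and n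
  proof -
    have "(z\<^sup>2 / 8) ^ n / fact n \<le> exp (z\<^sup>2 / 8)" by (rule power_over_fact_le_exp) simp
    then have 1: "(z\<^sup>2) ^ n \<le> 8 ^ n * fact n * exp (z\<^sup>2 / 8)"
      by (simp add: power_divide field_simps)
    have "\<bar>z ^ n\<bar> \<le> 1 + (z\<^sup>2) ^ n"
    proof -
      have "\<bar>w\<bar> \<le> 1 + w\<^sup>2" for w :: real
        using zero_le_power2[of "\<bar>w\<bar> - 1"] zero_le_power2[of w] by (simp add: power2_diff)
      from this[of "z ^ n"] show ?thesis by (simp only: power_mult[symmetric] mult.commute[of 2 n])
    qed
    moreover have "1 \<le> exp (z\<^sup>2 / 8)" by simp
    ultimately show ?thesis using 1 unfolding distrib_right mult_1 by linarith
  qed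
  define C where "C = (\<Sum>i\<le>degree P. \<bar>coeff P i\<bar> * (1 + 8 ^ i * fact i)) + 1"
  have "\<bar>poly P z\<bar> \<le> C * exp (z\<^sup>2 / 8)" for z
  proof -
    have "\<bar>poly P z\<bar> \<le> (\<Sum>i\<le>degree P. \<bar>coeff P i * z ^ i\<bar>)"
      unfolding poly_altdef by (rule sum_abs)
    also have "\<dots> \<le> (\<Sum>i\<le>degree P. \<bar>coeff P i\<bar> * ((1 + 8 ^ i * fact i) * exp (z\<^sup>2 / 8)))"
      unfolding abs_mult by (intro sum_mono mult_left_mono pw) auto
    also have "\<dots> \<le> C * exp (z\<^sup>2 / 8)"
      by (simp add: C_def distrib_right sum_distrib_right mult.assoc)
    finally show ?thesis .
  qed
  moreover have "C > 0" unfolding C_def by (intro add_nonneg_pos sum_nonneg) (auto intro!: mult_nonneg_nonneg add_nonneg_nonneg)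
  ultimately show ?thesis by blast
qed

text \<open>
  The chain of derivatives to which \<open>difference_stencil_exists\<close> is applied; every derivative of
  the kernel of squared width \<open>u\<close> gains a factor \<open>1 / sqrt u\<close>.
\<close>
lemma gaussian_derivatives:
  fixes u :: real
  assumes "u > 0"
  shows "((\<lambda>y. (1 / sqrt u) ^ n * (poly (hermite_poly n) (y / sqrt u) * exp (- (y\<^sup>2 / (4 * u)))))
     has_real_derivative
      (1 / sqrt u) ^ Suc n * (poly (hermite_poly (Suc n)) (y / sqrt u) * exp (- (y\<^sup>2 / (4 * u))))) (at y)"
proof -
  have s: "sqrt u > 0" "u = sqrt u * sqrt u" using assms by auto
  have e: "((\<lambda>y. exp (- (y\<^sup>2 / (4 * u)))) has_real_derivative exp (- (y\<^sup>2 / (4 * u))) * (- (2 * y) / (4 * u))) (at y)"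
    using assms by (auto intro!: derivative_eq_intros)
  have p: "((\<lambda>y. poly (hermite_poly n) (y / sqrt u)) has_real_derivative
      poly (pderiv (hermite_poly n)) (y / sqrt u) * (1 / sqrt u)) (at y)"
    by (rule DERIV_chain2[OF poly_DERIV DERIV_cdivide[OF DERIV_ident]])
  have v: "- (2 * y) / (4 * u) = (1 / sqrt u) * (- (1/2) * (y / sqrt u))"
  proof -
    have "1 / u = (1 / sqrt u) * (1 / sqrt u)" using s by (metis mult_1 times_divide_times_eq)
    moreover have "- (2 * y) / (4 * u) = - (1/2) * y * (1 / u)" by simp
    ultimately show ?thesis by simp
  qed
  show ?thesis
    by (rule DERIV_cong[OF DERIV_cmult[OF DERIV_mult[OF p e]]])
       (simp only: v hermite_poly.simps poly_diff poly_mult, simp add: algebra_simps)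
qed

text \<open>
  Gaussian decay is traded for quadratic decay, which no longer depends on the width \<open>u\<close> except
  through a factor that is affine in \<open>u\<close>.
\<close>
lemma exp_minus_square_le:
  fixes c u y :: real
  assumes "u > 0" "c \<ge> 1"
  shows "exp (- (y\<^sup>2 / (c * u))) \<le> c * (1 + u) / (1 + y\<^sup>2)"
proof -
  have "1 + y\<^sup>2 \<le> (c * (1 + u)) * (1 + y\<^sup>2 / (c * u))"
  proof -
    have "(c * (1 + u)) * (1 + y\<^sup>2 / (c * u)) = c * (1 + u) + (1 + u) / u * y\<^sup>2"
      using assms by (simp add: field_simps)
    moreover have "1 \<le> c * (1 + u)" using assms mult_mono[of 1 c 1 "1+u"] by simp
    moreover have "1 * y\<^sup>2 \<le> (1 + u) / u * y\<^sup>2" using assms by (intro mult_right_mono) (auto simp: field_simps)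
    ultimately show ?thesis by simp
  qed
  also have "\<dots> \<le> (c * (1 + u)) * exp (y\<^sup>2 / (c * u))"
    using assms by (intro mult_left_mono exp_ge_add_one_self) auto
  finally show ?thesis
    by (simp add: exp_minus field_simps add_pos_nonneg)
qed

lemma shift_square_le:
  fixes t y p :: real
  assumes "\<bar>t - y\<bar> \<le> p"
  shows "1 / (1 + t\<^sup>2) \<le> 2 * (1 + p\<^sup>2) / (1 + y\<^sup>2)"
proof -
  have "(t - y)\<^sup>2 \<le> p\<^sup>2" using power_mono[OF assms abs_ge_zero, of 2] by simp
  moreover have "y\<^sup>2 \<le> 2 * t\<^sup>2 + 2 * (t - y)\<^sup>2"
    using zero_le_power2[of "2 * t - y"] by (simp add: power2_eq_square algebra_simps)
  moreover have "2 * (1 + p\<^sup>2) * (1 + t\<^sup>2) = 2 + 2 * t\<^sup>2 + 2 * p\<^sup>2 + 2 * (p\<^sup>2 * t\<^sup>2)" by algebra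
  moreover have "0 \<le> p\<^sup>2 * t\<^sup>2" by simp
  ultimately have "1 + y\<^sup>2 \<le> 2 * (1 + p\<^sup>2) * (1 + t\<^sup>2)" by linarith
  then show ?thesis by (simp add: field_simps add_pos_nonneg)
qed

text \<open>
  For a wide kernel, \<open>u \<ge> 1\<close>, the stencil is bounded by the \<open>p\<close>-th derivative, which is of order
  \<open>u powr (- p / 2)\<close>. For a narrow one no cancellation is needed: then the power of \<open>1 + u\<close> is at most
  a constant, and the sum of the absolute values suffices.
\<close>
lemma gaussian_stencil_1d:
  "\<exists>(a::nat \<Rightarrow> real) C. a 0 \<noteq> 0 \<and> C > 0 \<and>
     (\<forall>u>0. \<forall>y. (\<Sum>k\<le>p. a k * exp (- ((y + real k)\<^sup>2 / (4 * u))))\<^sup>2 \<le> C * (1 + u) / (1 + u) ^ p / (1 + y\<^sup>2))"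
proof -
  obtain a :: "nat \<Rightarrow> real" where a0: "a 0 \<noteq> 0" and
    a: "\<And>D x B. (\<And>n y. (D n has_real_derivative D (Suc n) y) (at y)) \<Longrightarrow>
        (\<And>y. y \<in> {x..x + real p} \<Longrightarrow> \<bar>D p y\<bar> \<le> B) \<Longrightarrow>
        \<bar>\<Sum>k\<le>p. a k * D 0 (x + real k)\<bar> \<le> B"
    using difference_stencil_exists[of p] by blast
  obtain C1 where C1: "C1 > 0" "\<And>z. \<bar>poly (hermite_poly p) z\<bar> \<le> C1 * exp (z\<^sup>2 / 8)"
    using poly_le_exp_square by blast
  define S where "S = (\<Sum>k\<le>p. \<bar>a k\<bar>)"
  define R where "R = 2 * (1 + (real p)\<^sup>2)"
  have R: "R > 0" by (simp add: R_def add_pos_nonneg)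
  define C where "C = (C1\<^sup>2 + S\<^sup>2) * 2 ^ p * 4 * R"
  have C: "C > 0" unfolding C_def using C1(1) R by (auto intro!: mult_pos_pos add_pos_nonneg)
  have "(\<Sum>k\<le>p. a k * exp (- ((y + real k)\<^sup>2 / (4 * u))))\<^sup>2 \<le> C * (1 + u) / (1 + u) ^ p / (1 + y\<^sup>2)"
    if u: "u > 0" for u y
  proof -
    let ?L = "\<Sum>k\<le>p. a k * exp (- ((y + real k)\<^sup>2 / (4 * u)))"
    define E where "E = 4 * (1 + u) * R / (1 + y\<^sup>2)"
    have E: "E \<ge> 0" using R u by (simp add: E_def)
    have near: "exp (- (t\<^sup>2 / (4 * u))) \<le> E" if "\<bar>t - y\<bar> \<le> real p" for t
    proof -
      have "exp (- (t\<^sup>2 / (4 * u))) \<le> 4 * (1 + u) * (1 / (1 + t\<^sup>2))"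
        using exp_minus_square_le[of u 4 t] u by simp
      also have "\<dots> \<le> 4 * (1 + u) * (R / (1 + y\<^sup>2))"
        using shift_square_le[OF that] u by (intro mult_left_mono) (auto simp: R_def)
      finally show ?thesis by (simp add: E_def)
    qed
    have "?L\<^sup>2 \<le> (C1\<^sup>2 + S\<^sup>2) * 2 ^ p / (1 + u) ^ p * E"
    proof (cases "u \<ge> 1")
      case True
      define D where "D n y = (1 / sqrt u) ^ n * (poly (hermite_poly n) (y / sqrt u) * exp (- (y\<^sup>2 / (4 * u))))" for n y
      have bound: "\<bar>D p t\<bar> \<le> (1 / sqrt u) ^ p * C1 * sqrt E" if "t \<in> {y..y + real p}" for t
      proof -
        have "\<bar>poly (hermite_poly p) (t / sqrt u)\<bar> * exp (- (t\<^sup>2 / (4 * u)))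
            \<le> C1 * exp (t\<^sup>2 / (8 * u)) * exp (- (t\<^sup>2 / (4 * u)))"
          using C1(2)[of "t / sqrt u"] u by (intro mult_right_mono) (auto simp: power_divide mult.commute)
        also have "\<dots> = C1 * exp (- (t\<^sup>2 / (8 * u)))"
          by (simp add: mult.assoc flip: exp_add)
        also have "exp (- (t\<^sup>2 / (8 * u))) = sqrt (exp (- (t\<^sup>2 / (4 * u))))"
          by (rule real_sqrt_unique[symmetric]) (simp_all add: exp_double[symmetric] field_simps)
        also have "C1 * \<dots> \<le> C1 * sqrt E"
          using near[of t] that C1(1) by (intro mult_left_mono) auto
        finally show ?thesis
          using u by (simp add: D_def abs_mult mult.assoc divide_right_mono power_abs)
      qed
      have "\<bar>\<Sum>k\<le>p. a k * D 0 (y + real k)\<bar> \<le> (1 / sqrt u) ^ p * C1 * sqrt E"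
        by (rule a) (use bound gaussian_derivatives[OF u] in \<open>auto simp: D_def\<close>)
      then have "\<bar>?L\<bar> \<le> (1 / sqrt u) ^ p * C1 * sqrt E" by (simp add: D_def)
      from power_mono[OF this abs_ge_zero, of 2]
      have "?L\<^sup>2 \<le> ((1 / sqrt u) ^ p * C1 * sqrt E)\<^sup>2" by simp
      also have "\<dots> = C1\<^sup>2 * (1 / u) ^ p * E"
        using u E by (simp add: power_mult_distrib power_divide power_mult[symmetric] mult.commute[of _ 2])
          (simp add: power_mult)
      also have "\<dots> \<le> (C1\<^sup>2 + S\<^sup>2) * (2 / (1 + u)) ^ p * E"
        using True E by (intro mult_right_mono mult_mono power_mono) (auto simp: field_simps)
      finally show ?thesis by (simp add: power_divide)
    next
      case False
      have "\<bar>?L\<bar> \<le> (\<Sum>k\<le>p. \<bar>a k\<bar> * sqrt E)"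
      proof (rule order_trans[OF sum_abs], rule sum_mono)
        fix k assume k: "k \<in> {..p}"
        \<comment> \<open>as \<open>?e \<le> 1\<close>, a bound for \<open>?e\<close> also bounds its square\<close>
        let ?e = "exp (- ((y + real k)\<^sup>2 / (4 * u)))"
        have "?e\<^sup>2 \<le> ?e" by (auto simp: power2_eq_square intro!: mult_left_le divide_nonneg_pos u)
        also have "\<dots> \<le> E" using k by (intro near) auto
        finally have "?e \<le> sqrt E" by (rule real_le_rsqrt)
        then show "\<bar>a k * ?e\<bar> \<le> \<bar>a k\<bar> * sqrt E" by (simp add: abs_mult mult_left_mono)
      qed
      also have "\<dots> = S * sqrt E" by (simp add: S_def sum_distrib_right)
      finally have "\<bar>?L\<bar> \<le> S * sqrt E" .
      from power_mono[OF this abs_ge_zero, of 2]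
      have "?L\<^sup>2 \<le> S\<^sup>2 * 1 * E" using E by (simp add: power_mult_distrib)
      also have "\<dots> \<le> (C1\<^sup>2 + S\<^sup>2) * (2 / (1 + u)) ^ p * E"
        using False E u by (intro mult_right_mono mult_mono one_le_power) (auto simp: field_simps)
      finally show ?thesis by (simp add: power_divide)
    qed
    also have "\<dots> = C * (1 + u) / (1 + u) ^ p / (1 + y\<^sup>2)"
      by (simp add: C_def E_def)
    finally show ?thesis .
  qed
  with a0 C show ?thesis by blast
qed

text \<open>
  A product over the coordinates, so that its sums over a grid factor into one-dimensional sums.
\<close>
definition lattice_weight :: "real ^ 'n \<Rightarrow> real" where
  "lattice_weight x = (\<Prod>i\<in>UNIV. 1 / (1 + (x $ i)\<^sup>2))"

lemma norm_square_vec: "(norm (x :: real ^ 'n))\<^sup>2 = (\<Sum>i\<in>UNIV. (x $ i)\<^sup>2)"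
  unfolding power2_norm_eq_inner inner_vec_def by (simp add: power2_eq_square)

text \<open>
  Differencing in the single direction \<open>c\<close> suffices, because the kernel is a product: the other
  coordinates contribute Gaussian factors, each of which costs a factor of order \<open>1 + u\<close> in the squared bound when its
  decay is made independent of \<open>u\<close>. The order \<open>2 * m + CARD('n)\<close> of the stencil pays for these
  factors and leaves \<open>(1 + u) ^ m\<close> in the denominator.
\<close>
lemma gaussian_stencil:
  fixes c :: "'n::finite"
  shows "\<exists>(a::nat \<Rightarrow> real) C. a 0 \<noteq> 0 \<and> C > 0 \<and>
     (\<forall>u>0. \<forall>x :: real ^ 'n. \<bar>\<Sum>k\<le>2 * m + CARD('n). a k * exp (- ((norm (x + real k *\<^sub>R axis c 1))\<^sup>2 / (4 * u)))\<bar>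
        \<le> C / (1 + u) ^ m * sqrt (lattice_weight x))"
proof -
  let ?p = "2 * m + CARD('n)" and ?R = "UNIV - {c} :: 'n set"
  obtain a :: "nat \<Rightarrow> real" and C where a: "a 0 \<noteq> 0" "C > 0"
    "\<And>u y. u > 0 \<Longrightarrow> (\<Sum>k\<le>?p. a k * exp (- ((y + real k)\<^sup>2 / (4 * u))))\<^sup>2 \<le> C * (1 + u) / (1 + u) ^ ?p / (1 + y\<^sup>2)"
    using gaussian_stencil_1d[of ?p] by blast
  define N where "N = card ?R"
  define C' where "C' = C * 2 ^ N"
  have "\<bar>\<Sum>k\<le>?p. a k * exp (- ((norm (x + real k *\<^sub>R axis c 1))\<^sup>2 / (4 * u)))\<bar>
        \<le> sqrt C' / (1 + u) ^ m * sqrt (lattice_weight x)" if u: "u > 0" for u and x :: "real ^ 'n"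
  proof -
    let ?S = "\<Sum>k\<le>?p. a k * exp (- ((x $ c + real k)\<^sup>2 / (4 * u)))"
    let ?E = "\<Prod>i\<in>?R. exp (- ((x $ i)\<^sup>2 / (4 * u)))"
    have split: "exp (- ((norm (x + real k *\<^sub>R axis c 1))\<^sup>2 / (4 * u))) = exp (- ((x $ c + real k)\<^sup>2 / (4 * u))) * ?E" for k
    proof -
      have "exp (- ((norm (x + real k *\<^sub>R axis c 1))\<^sup>2 / (4 * u))) =
         (\<Prod>i\<in>UNIV. exp (- (((x + real k *\<^sub>R axis c 1) $ i)\<^sup>2 / (4 * u))))"
        by (simp add: norm_square_vec sum_divide_distrib exp_sum sum_negf[symmetric])
      also have "\<dots> = exp (- (((x + real k *\<^sub>R axis c 1) $ c)\<^sup>2 / (4 * u))) *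
         (\<Prod>i\<in>?R. exp (- (((x + real k *\<^sub>R axis c 1) $ i)\<^sup>2 / (4 * u))))"
        by (rule prod.remove) auto
      also have "(\<Prod>i\<in>?R. exp (- (((x + real k *\<^sub>R axis c 1) $ i)\<^sup>2 / (4 * u)))) = ?E"
        by (intro prod.cong) (auto simp: axis_def)
      finally show ?thesis by (simp add: axis_def)
    qed
    have "?E\<^sup>2 = (\<Prod>i\<in>?R. exp (- ((x $ i)\<^sup>2 / (2 * u))))"
      unfolding prod_power_distrib by (intro prod.cong) (auto simp: exp_double[symmetric] field_simps)
    also have "\<dots> \<le> (\<Prod>i\<in>?R. 2 * (1 + u) * (1 / (1 + (x $ i)\<^sup>2)))"
      by (intro prod_mono) (use exp_minus_square_le[OF u, of 2] in auto)
    also have "\<dots> = 2 ^ N * (1 + u) ^ N * (\<Prod>i\<in>?R. 1 / (1 + (x $ i)\<^sup>2))"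
      by (simp only: prod.distrib prod_constant power_mult_distrib N_def)
    finally have E2: "?E\<^sup>2 \<le> 2 ^ N * (1 + u) ^ N * (\<Prod>i\<in>?R. 1 / (1 + (x $ i)\<^sup>2))" .
    have "(?S * ?E)\<^sup>2 = ?S\<^sup>2 * ?E\<^sup>2" by (rule power_mult_distrib)
    also have "\<dots> \<le> (C * (1 + u) / (1 + u) ^ ?p / (1 + (x $ c)\<^sup>2)) *
       (2 ^ N * (1 + u) ^ N * (\<Prod>i\<in>?R. 1 / (1 + (x $ i)\<^sup>2)))"
      using a(2) u by (intro mult_mono a(3) E2) auto
    also have "\<dots> = C' * (1 + u) ^ Suc N / (1 + u) ^ ?p * (1 / (1 + (x $ c)\<^sup>2) * (\<Prod>i\<in>?R. 1 / (1 + (x $ i)\<^sup>2)))"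
      by (simp add: C'_def)
    also have "1 / (1 + (x $ c)\<^sup>2) * (\<Prod>i\<in>?R. 1 / (1 + (x $ i)\<^sup>2)) = lattice_weight x"
      unfolding lattice_weight_def by (subst (2) prod.remove[of _ c]) auto
    also have "Suc N = CARD('n)" by (simp add: N_def)
    also have "C' * (1 + u) ^ CARD('n) / (1 + u) ^ ?p = C' / ((1 + u) ^ m)\<^sup>2"
      using u by (simp add: power_add mult_2 power2_eq_square)
    finally have "\<bar>?S * ?E\<bar> \<le> sqrt (C' / ((1 + u) ^ m)\<^sup>2 * lattice_weight x)"
      using real_sqrt_le_mono[of "(?S * ?E)\<^sup>2"] by simp
    also have "\<dots> = sqrt C' / (1 + u) ^ m * sqrt (lattice_weight x)"
      using u by (simp add: real_sqrt_mult real_sqrt_divide)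
    finally show ?thesis unfolding split by (simp add: sum_distrib_right mult.assoc)
  qed
  moreover have "sqrt C' > 0" using a(2) by (simp add: C'_def)
  ultimately show ?thesis using a(1) by blast
qed

section \<open>Finite differences of the Matern covariance\<close>

lemma integrable_power_tail_kernel:
  fixes \<nu> :: real and m :: nat
  assumes "\<nu> > 0" "real m > \<nu>"
  shows "integrable lborel (\<lambda>v. indicator {0<..} v * (v powr (\<nu> - 1) / (1 + v) ^ m))"
proof -
  let ?f = "\<lambda>v::real. v powr (\<nu> - 1) / (1 + v) ^ m"
  have "(\<lambda>v. v powr (\<nu> - 1)) integrable_on {0..1}"
    using assms by (intro integrable_on_powr_from_0) auto
  then have "set_integrable lebesgue {0..1} (\<lambda>v::real. v powr (\<nu> - 1))"
    by (intro nonnegative_absolutely_integrable_1) auto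
  then have "integrable lborel (\<lambda>v. indicator {0..1} v * v powr (\<nu> - 1))"
    unfolding set_integrable_def by (subst (asm) integrable_completion) auto
  then have 1: "integrable lborel (\<lambda>v. indicator {0<..1} v * ?f v)"
    by (rule Bochner_Integration.integrable_bound)
       (auto simp: indicator_def divide_le_eq intro!: AE_I2 mult_le_cancel_left1[THEN iffD2])
  have "(\<lambda>v. v powr (\<nu> - 1 - real m)) integrable_on {1..}"
    using has_integral_powr_to_inf[of "\<nu> - 1 - real m" 1] assms by (auto simp: integrable_on_def)
  then have "set_integrable lebesgue {1..} (\<lambda>v::real. v powr (\<nu> - 1 - real m))"
    by (intro nonnegative_absolutely_integrable_1) auto
  then have "integrable lborel (\<lambda>v. indicator {1..} v * v powr (\<nu> - 1 - real m))"
    unfolding set_integrable_def by (subst (asm) integrable_completion) auto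
  then have 2: "integrable lborel (\<lambda>v. indicator {1<..} v * ?f v)"
  proof (rule Bochner_Integration.integrable_bound)
    have "?f v \<le> v powr (\<nu> - 1 - real m)" if "v > 1" for v
    proof -
      have "v ^ m \<le> (1 + v) ^ m" using that by (intro power_mono) auto
      then have "?f v \<le> v powr (\<nu> - 1) / v ^ m" using that by (intro divide_left_mono) auto
      then show ?thesis using that by (simp add: powr_diff powr_realpow)
    qed
    then show "AE v in lborel. norm (indicator {1<..} v * ?f v) \<le> norm (indicator {1..} v * v powr (\<nu> - 1 - real m))"
      by (intro AE_I2) (auto simp: indicator_def)
  qed auto
  have "indicator {0<..} v * ?f v = indicator {0<..1} v * ?f v + indicator {1<..} v * ?f v" for v
    by (auto simp: indicator_def)
  then show ?thesis using 1 2 by simp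
qed

lemma lattice_weight_nonneg: "lattice_weight x \<ge> 0"
  unfolding lattice_weight_def by (intro prod_nonneg) auto

text \<open>
  Integration of \<open>gaussian_stencil\<close> over the mixture, with \<open>u = v / r^2\<close>. The power \<open>m > \<nu>\<close>
  makes the integral converge at infinity, and the scaling of \<open>v powr (\<nu> - 1) dv\<close> yields
  \<open>r powr (2 * \<nu>)\<close> before squaring. The bound is uniform in \<open>A\<close>, since \<open>exp (- (A * v)) \<le> 1\<close>.
\<close>
lemma matern_mix_stencil_bound:
  fixes c :: "'n::finite"
  assumes nu: "\<nu> > 0" and m: "real m > \<nu>"
  shows "\<exists>(a::nat \<Rightarrow> real) C. a 0 \<noteq> 0 \<and> C > 0 \<and>
     (\<forall>A>0. \<forall>r>0. \<forall>x :: real ^ 'n.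
        (\<Sum>k\<le>2 * m + CARD('n). a k * matern_mix \<nu> A ((norm (x + (r * real k) *\<^sub>R axis c 1))\<^sup>2))\<^sup>2
        \<le> C * r powr (4 * \<nu>) * lattice_weight (x /\<^sub>R r))"
proof -
  let ?p = "2 * m + CARD('n)"
  obtain a :: "nat \<Rightarrow> real" and C where a0: "a 0 \<noteq> 0" and C: "C > 0" and
    a: "\<And>u (x :: real ^ 'n). u > 0 \<Longrightarrow> \<bar>\<Sum>k\<le>?p. a k * exp (- ((norm (x + real k *\<^sub>R axis c 1))\<^sup>2 / (4 * u)))\<bar>
        \<le> C / (1 + u) ^ m * sqrt (lattice_weight x)"
    using gaussian_stencil[where m = m and c = c] by blast
  define f where "f v = indicator {0<..} v * (v powr (\<nu> - 1) / (1 + v) ^ m)" for v :: real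
  define I where "I = (\<integral>v. f v \<partial>lborel)"
  have f: "integrable lborel f" unfolding f_def by (rule integrable_power_tail_kernel) fact+
  have I: "I \<ge> 0" unfolding I_def f_def by (intro integral_nonneg_AE AE_I2) (auto simp: indicator_def)
  have main: "(\<Sum>k\<le>?p. a k * matern_mix \<nu> A ((norm (x + (r * real k) *\<^sub>R axis c 1))\<^sup>2))\<^sup>2
        \<le> (C\<^sup>2 * I\<^sup>2) * r powr (4 * \<nu>) * lattice_weight (x /\<^sub>R r)" (is "?L\<^sup>2 \<le> _")
    if A: "A > 0" and r: "r > 0" for A r and x :: "real ^ 'n"
  proof -
    define W where "W = sqrt (lattice_weight (x /\<^sub>R r))"
    have W: "W \<ge> 0" by (simp add: W_def lattice_weight_nonneg)
    define s where "s k = (norm (x + (r * real k) *\<^sub>R axis c 1))\<^sup>2" for k :: nat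
    let ?g = "\<lambda>v k. indicator {0<..} v * (v powr (\<nu> - 1) * exp (- (A * v)) * exp (- (s k / (4 * v))))"
    let ?h = "\<lambda>v. \<Sum>k\<le>?p. a k * ?g v k"
    have gi: "integrable lborel (\<lambda>v. ?g v k)" for k
      by (rule integrable_matern_mix) (use nu A in \<open>auto simp: s_def\<close>)
    have L: "?L = (\<integral>v. ?h v \<partial>lborel)"
      unfolding matern_mix_def s_def[symmetric]
      by (subst Bochner_Integration.integral_sum) (use gi in auto)
    have pw: "\<bar>?h v\<bar> \<le> C * W * (r\<^sup>2 powr (\<nu> - 1)) * f (0 + (1 / r\<^sup>2) * v)" for v
    proof (cases "v > 0")
      case True
      define u where "u = v / r\<^sup>2"
      have u: "u > 0" "v = r\<^sup>2 * u" using True r by (auto simp: u_def)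
      have s: "s k / (4 * v) = (norm (x /\<^sub>R r + real k *\<^sub>R axis c 1))\<^sup>2 / (4 * u)" for k
      proof -
        have "x + (r * real k) *\<^sub>R axis c 1 = r *\<^sub>R (x /\<^sub>R r + real k *\<^sub>R axis c 1)"
          using r by (simp add: scaleR_add_right)
        then have "s k = r\<^sup>2 * (norm (x /\<^sub>R r + real k *\<^sub>R axis c 1))\<^sup>2"
          unfolding s_def by (simp only: norm_scaleR power_mult_distrib power2_abs)
        then show ?thesis using u r by simp
      qed
      have "?h v = v powr (\<nu> - 1) * exp (- (A * v)) * (\<Sum>k\<le>?p. a k * exp (- (s k / (4 * v))))"
        using True by (simp add: sum_distrib_left mult_ac)
      then have "\<bar>?h v\<bar> = v powr (\<nu> - 1) * exp (- (A * v)) * \<bar>\<Sum>k\<le>?p. a k * exp (- (s k / (4 * v)))\<bar>"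
        by (simp add: abs_mult)
      also have "\<dots> \<le> v powr (\<nu> - 1) * 1 * (C / (1 + u) ^ m * W)"
        unfolding s W_def using a[OF u(1)] A True by (intro mult_mono) auto
      also have "\<dots> = C * W * (r\<^sup>2 powr (\<nu> - 1)) * f u"
        using u r by (simp add: f_def powr_mult)
      finally show ?thesis by (simp add: u_def)
    qed (use C W r in \<open>auto simp: f_def indicator_def zero_less_divide_iff\<close>)
    have int: "integrable lborel (\<lambda>v. f (0 + (1 / r\<^sup>2) * v))"
      using r by (intro lborel_integrable_real_affine f) auto
    have "\<bar>?L\<bar> \<le> (\<integral>v. \<bar>?h v\<bar> \<partial>lborel)"
      unfolding L by (rule integral_abs_bound)
    also have "\<dots> \<le> (\<integral>v. C * W * (r\<^sup>2 powr (\<nu> - 1)) * f (0 + (1 / r\<^sup>2) * v) \<partial>lborel)"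
      using gi int by (intro integral_mono pw integrable_abs integrable_mult_right Bochner_Integration.integrable_sum) auto
    also have "\<dots> = C * W * (r\<^sup>2 powr (\<nu> - 1)) * (r\<^sup>2 * I)"
      using lborel_integral_real_affine[of "1 / r\<^sup>2" f 0] r by (simp add: I_def)
    also have "\<dots> = C * W * I * r powr (2 * \<nu>)"
    proof -
      have "r\<^sup>2 powr (\<nu> - 1) * r\<^sup>2 = r powr (2 * \<nu>)"
        using r by (simp add: powr_powr powr_diff field_simps flip: powr_numeral)
      then show ?thesis by (simp add: mult_ac)
    qed
    finally have "\<bar>?L\<bar> \<le> C * W * I * r powr (2 * \<nu>)" .
    from power_mono[OF this abs_ge_zero, of 2]
    have "?L\<^sup>2 \<le> (C * W * I * r powr (2 * \<nu>))\<^sup>2" by simp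
    also have "\<dots> = (C\<^sup>2 * I\<^sup>2) * (r powr (2 * \<nu>))\<^sup>2 * lattice_weight (x /\<^sub>R r)"
      by (simp add: power_mult_distrib W_def lattice_weight_nonneg)
    also have "(r powr (2 * \<nu>))\<^sup>2 = r powr (4 * \<nu>)"
      by (simp add: power2_eq_square flip: powr_add)
    finally show ?thesis .
  qed
  \<comment> \<open>adding 1 makes the constant positive without computing the integral \<open>I\<close>\<close>
  have "(C\<^sup>2 * I\<^sup>2) * r powr (4 * \<nu>) * lattice_weight y \<le> (C\<^sup>2 * I\<^sup>2 + 1) * r powr (4 * \<nu>) * lattice_weight y"
    for r and y :: "real ^ 'n"
    by (intro mult_right_mono lattice_weight_nonneg) auto
  then have "\<forall>A>0. \<forall>r>0. \<forall>x :: real ^ 'n.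
        (\<Sum>k\<le>?p. a k * matern_mix \<nu> A ((norm (x + (r * real k) *\<^sub>R axis c 1))\<^sup>2))\<^sup>2
        \<le> (C\<^sup>2 * I\<^sup>2 + 1) * r powr (4 * \<nu>) * lattice_weight (x /\<^sub>R r)"
    using main by (meson order_trans)
  moreover have "C\<^sup>2 * I\<^sup>2 + 1 > 0" by (simp add: add_nonneg_pos)
  ultimately show ?thesis using a0 by blast
qed

text \<open>
  Up to a constant factor, \<open>- s\<close> may be replaced by an integer \<open>j\<close> at distance at most 1. Then
  every value of \<open>\<bar>k - j\<bar>\<close> occurs at most twice.
\<close>
lemma sum_inverse_square_shift_bound:
  "\<exists>B>0. \<forall>(s::real) n. (\<Sum>k<n. 1 / (1 + (s + real k)\<^sup>2)) \<le> B"
proof -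
  define g where "g l = 1 / (1 + (real l)\<^sup>2)" for l :: nat
  have g0: "g l \<ge> 0" for l by (simp add: g_def)
  have "summable (\<lambda>l. 1 / (real (Suc l))\<^sup>2)"
    using inverse_squares_sums by (simp add: sums_iff add.commute)
  then have "summable (\<lambda>l. g (Suc l))"
    by (rule summable_comparison_test'[where N=0])
       (auto simp: g_def intro!: divide_left_mono mult_pos_pos add_pos_nonneg)
  then have sg: "summable g" by (simp add: summable_Suc_iff)
  have gB: "sum g F \<le> suminf g" if "finite F" for F
    using sg that g0 by (intro sum_le_suminf) auto
  have "(\<Sum>k<n. 1 / (1 + (s + real k)\<^sup>2)) \<le> 8 * suminf g + 1" for s :: real and n
  proof -
    define j where "j = - \<lfloor>s\<rfloor>"
    have near: "\<bar>(s + real k) - (real k - real_of_int j)\<bar> \<le> 1" for k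
      using floor_correct[of s] by (simp add: j_def) linarith
    have le: "1 / (1 + (s + real k)\<^sup>2) \<le> 4 * g (nat \<bar>int k - j\<bar>)" for k
    proof -
      have "1 / (1 + (s + real k)\<^sup>2) \<le> 2 * (1 + 1\<^sup>2) / (1 + (real k - real_of_int j)\<^sup>2)"
        by (rule shift_square_le[OF near])
      moreover have "(real (nat \<bar>int k - j\<bar>))\<^sup>2 = (real k - real_of_int j)\<^sup>2"
      proof -
        have "real (nat \<bar>int k - j\<bar>) = \<bar>real k - real_of_int j\<bar>" by simp
        then show ?thesis by simp
      qed
      ultimately show ?thesis by (simp add: g_def)
    qed
    let ?A = "{k\<in>{..<n}. int k \<ge> j}" and ?B = "{k\<in>{..<n}. int k < j}"
    have "(\<Sum>k\<in>?A. g (nat \<bar>int k - j\<bar>)) = sum g ((\<lambda>k. nat \<bar>int k - j\<bar>) ` ?A)"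
      by (subst sum.reindex) (auto intro!: inj_onI simp: o_def)
    also have "\<dots> \<le> suminf g" by (intro gB) auto
    finally have A: "(\<Sum>k\<in>?A. g (nat \<bar>int k - j\<bar>)) \<le> suminf g" .
    have "(\<Sum>k\<in>?B. g (nat \<bar>int k - j\<bar>)) = sum g ((\<lambda>k. nat \<bar>int k - j\<bar>) ` ?B)"
      by (subst sum.reindex) (auto intro!: inj_onI simp: o_def)
    also have "\<dots> \<le> suminf g" by (intro gB) auto
    finally have B: "(\<Sum>k\<in>?B. g (nat \<bar>int k - j\<bar>)) \<le> suminf g" .
    have "(\<Sum>k<n. 1 / (1 + (s + real k)\<^sup>2)) \<le> (\<Sum>k<n. 4 * g (nat \<bar>int k - j\<bar>))"
      by (intro sum_mono le)
    also have "\<dots> = 4 * (\<Sum>k\<in>?A \<union> ?B. g (nat \<bar>int k - j\<bar>))"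
      unfolding sum_distrib_left by (intro sum.cong) auto
    also have "(\<Sum>k\<in>?A \<union> ?B. g (nat \<bar>int k - j\<bar>)) = (\<Sum>k\<in>?A. g (nat \<bar>int k - j\<bar>)) + (\<Sum>k\<in>?B. g (nat \<bar>int k - j\<bar>))"
      by (intro sum.union_disjoint) auto
    finally show ?thesis using A B by simp
  qed
  moreover have "8 * suminf g + 1 > 0" using suminf_nonneg[OF sg g0] by simp
  ultimately show ?thesis by blast
qed

text \<open>
  Grid points are functions on the index type, so that sums of products over the grid are covered
  by \<open>prod_sum_PiE\<close>.
\<close>
definition cube_grid :: "nat \<Rightarrow> ('n::finite \<Rightarrow> nat) set" where
  "cube_grid n = (\<Pi>\<^sub>E i\<in>UNIV. {..<n})"

lemma finite_cube_grid [simp]: "finite (cube_grid n)"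
  unfolding cube_grid_def by (intro finite_PiE) auto

lemma card_cube_grid: "card (cube_grid n :: ('n::finite \<Rightarrow> nat) set) = n ^ CARD('n)"
  unfolding cube_grid_def by (subst card_PiE) auto

lemma cube_gridD: "i \<in> cube_grid n \<Longrightarrow> i c < n"
  by (auto simp: cube_grid_def PiE_def Pi_def)

lemma lattice_weight_sum_bound:
  "\<exists>B>0. \<forall>(y :: real ^ 'n::finite) n. (\<Sum>i\<in>cube_grid n. lattice_weight (y + (\<chi> c. real (i c)))) \<le> B"
proof -
  obtain B where B: "B > 0" "\<And>(s::real) n. (\<Sum>k<n. 1 / (1 + (s + real k)\<^sup>2)) \<le> B"
    using sum_inverse_square_shift_bound by blast
  have "(\<Sum>i\<in>cube_grid n. lattice_weight (y + (\<chi> c. real (i c)))) \<le> B ^ CARD('n)" for y :: "real ^ 'n" and n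
  proof -
    have "(\<Sum>i\<in>cube_grid n. lattice_weight (y + (\<chi> c. real (i c)))) = (\<Prod>c\<in>UNIV. \<Sum>k<n. 1 / (1 + (y $ c + real k)\<^sup>2))"
      unfolding lattice_weight_def cube_grid_def by (subst prod_sum_PiE) auto
    also have "\<dots> \<le> (\<Prod>c\<in>(UNIV :: 'n set). B)"
      by (intro prod_mono conjI B sum_nonneg) auto
    finally show ?thesis by simp
  qed
  then show ?thesis using B(1) by (intro exI[of _ "B ^ CARD('n)"]) auto
qed

text \<open>
  After the factors depending on \<open>k\<close> or \<open>l\<close> alone are absorbed into the coefficients, the kernel is
  \<open>exp (\<tau> * k * l)\<close>, and its power series is a sum of squares with nonnegative coefficients.
\<close>
lemma gaussian_kernel_psd:
  fixes a :: "nat \<Rightarrow> real"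
  assumes "w > 0"
  shows "(\<Sum>k\<le>p. \<Sum>l\<le>p. a k * a l * exp (- ((real k - real l)\<^sup>2 / (4 * w)))) \<ge> 0"
proof -
  define b where "b k = a k * exp (- ((real k)\<^sup>2 / (4 * w)))" for k
  define \<tau> where "\<tau> = 1 / (2 * w)"
  have \<tau>: "\<tau> > 0" using assms by (simp add: \<tau>_def)
  have e: "a k * a l * exp (- ((real k - real l)\<^sup>2 / (4 * w))) = b k * b l * exp (\<tau> * real k * real l)" for k l
  proof -
    have "- ((real k - real l)\<^sup>2 / (4 * w)) = - ((real k)\<^sup>2 / (4 * w)) + - ((real l)\<^sup>2 / (4 * w)) + \<tau> * real k * real l"
      using assms by (simp add: \<tau>_def field_simps power2_eq_square)
    then show ?thesis unfolding b_def by (simp only: exp_add mult_ac)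
  qed
  have sums: "(\<lambda>n. \<Sum>k\<le>p. \<Sum>l\<le>p. b k * b l * ((\<tau> * real k * real l) ^ n /\<^sub>R fact n)) sums
     (\<Sum>k\<le>p. \<Sum>l\<le>p. b k * b l * exp (\<tau> * real k * real l))"
    by (intro sums_sum sums_mult exp_converges)
  have sq: "(\<Sum>k\<le>p. \<Sum>l\<le>p. b k * b l * ((\<tau> * real k * real l) ^ n /\<^sub>R fact n))
      = \<tau> ^ n / fact n * (\<Sum>k\<le>p. b k * real k ^ n)\<^sup>2" for n
    unfolding power2_eq_square sum_product unfolding sum_distrib_left
    by (intro sum.cong refl) (simp add: power_mult_distrib divide_inverse mult_ac)
  have "(\<Sum>k\<le>p. \<Sum>l\<le>p. b k * b l * exp (\<tau> * real k * real l)) \<ge> 0"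
    using \<tau> by (intro sums_le[OF _ sums_zero sums[unfolded sq]]) auto
  then show ?thesis unfolding e .
qed

text \<open>
  As the width tends to 0, the kernel matrix tends to the identity matrix, so the form tends to
  the sum of the squared coefficients.
\<close>
lemma gaussian_kernel_near_diagonal:
  fixes a :: "nat \<Rightarrow> real"
  assumes "a 0 \<noteq> 0"
  shows "\<exists>w0>0. \<exists>\<psi>>0. \<forall>w. 0 < w \<and> w \<le> w0 \<longrightarrow>
    (\<Sum>k\<le>p. \<Sum>l\<le>p. a k * a l * exp (- ((real k - real l)\<^sup>2 / (4 * w)))) \<ge> \<psi>"
proof -
  let ?\<psi> = "\<lambda>w. \<Sum>k\<le>p. \<Sum>l\<le>p. a k * a l * exp (- ((real k - real l)\<^sup>2 / (4 * w)))"
  define S where "S = (\<Sum>k\<le>p. (a k)\<^sup>2)"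
  have S: "S > 0" unfolding S_def using assms by (intro sum_pos2[of _ 0]) auto
  have lim: "((\<lambda>w. exp (- (d\<^sup>2 / (4 * w)))) \<longlongrightarrow> (if d = 0 then 1 else 0)) (at_right 0)" for d :: real
  proof (cases "d = 0")
    case False
    have "filterlim (\<lambda>w. d\<^sup>2 / 4 * inverse w) at_top (at_right (0::real))"
      using False by (intro filterlim_tendsto_pos_mult_at_top[OF tendsto_const _ filterlim_inverse_at_top_right]) simp
    then have "((\<lambda>w. exp (- (d\<^sup>2 / 4 * inverse w))) \<longlongrightarrow> 0) (at_right 0)"
      unfolding filterlim_uminus_at_top by (rule filterlim_compose[OF exp_at_bot])
    moreover have "d\<^sup>2 / 4 * inverse w = d\<^sup>2 / (4 * w)" for w :: real by (simp add: field_simps)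
    ultimately have "((\<lambda>w. exp (- (d\<^sup>2 / (4 * w)))) \<longlongrightarrow> 0) (at_right 0)" by (simp only:)
    then show ?thesis using False by simp
  qed auto
  have "(?\<psi> \<longlongrightarrow> (\<Sum>k\<le>p. \<Sum>l\<le>p. a k * a l * (if real k - real l = 0 then 1 else 0))) (at_right 0)"
    by (intro tendsto_sum tendsto_mult tendsto_const lim)
  also have "(\<Sum>k\<le>p. \<Sum>l\<le>p. a k * a l * (if real k - real l = 0 then 1 else 0)) = S"
    unfolding S_def by (intro sum.cong refl) (simp add: power2_eq_square if_distrib cong: if_cong)
  finally have "(?\<psi> \<longlongrightarrow> S) (at_right 0)" .
  then have "eventually (\<lambda>w. ?\<psi> w > S / 2) (at_right 0)"
    using S by (intro order_tendstoD) auto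
  then obtain b where b: "b > 0" "\<And>w. 0 < w \<Longrightarrow> w < b \<Longrightarrow> ?\<psi> w > S / 2"
    unfolding eventually_at_right_field by auto
  then show ?thesis
    using S by (intro exI[of _ "b / 2"] conjI exI[of _ "S / 2"]) (auto intro: less_imp_le)
qed

text \<open>
  The integrand for the difference of the two forms is \<open>exp (- (A1 * v)) - exp (- (A2 * v))\<close> times
  a positive semidefinite form, hence nonnegative, and it may be cut off at \<open>v = w0 * r^2\<close>. Up to there
  the form is bounded below by \<open>gaussian_kernel_near_diagonal\<close> and the difference of the exponentials
  by a multiple of \<open>v\<close>; the integral of \<open>v powr \<nu>\<close> gives \<open>r powr (2 * \<nu> + 2)\<close>.
\<close>
lemma matern_mix_stencil_gap:
  fixes a :: "nat \<Rightarrow> real"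
  assumes nu: "\<nu> > 0" and A: "0 < A1" "A1 < A2" and a0: "a 0 \<noteq> 0"
  shows "\<exists>\<delta>>0. \<forall>r. 0 < r \<and> r \<le> 1 \<longrightarrow>
     (\<Sum>k\<le>p. \<Sum>l\<le>p. a k * a l * (matern_mix \<nu> A1 ((r * (real k - real l))\<^sup>2) - matern_mix \<nu> A2 ((r * (real k - real l))\<^sup>2)))
       \<ge> \<delta> * r powr (2 * \<nu> + 2)"
proof -
  obtain w0 \<psi>0 where w0: "w0 > 0" "\<psi>0 > 0" and
    low: "\<And>w. 0 < w \<Longrightarrow> w \<le> w0 \<Longrightarrow> (\<Sum>k\<le>p. \<Sum>l\<le>p. a k * a l * exp (- ((real k - real l)\<^sup>2 / (4 * w)))) \<ge> \<psi>0"
    using gaussian_kernel_near_diagonal[where a = a and p = p, OF a0] by blast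
  \<comment> \<open>the slope of \<open>exp (- (A1 * v)) - exp (- (A2 * v))\<close> from below on \<open>0 < v \<le> w0\<close>\<close>
  define \<kappa> where "\<kappa> = (A2 - A1) * exp (- (A2 * w0))"
  have \<kappa>: "\<kappa> > 0" using A by (simp add: \<kappa>_def)
  define \<delta> where "\<delta> = \<kappa> * \<psi>0 * (w0 powr (\<nu> + 1) / (\<nu> + 1))"
  have \<delta>: "\<delta> > 0" using \<kappa> w0 nu by (simp add: \<delta>_def)
  have "(\<Sum>k\<le>p. \<Sum>l\<le>p. a k * a l * (matern_mix \<nu> A1 ((r * (real k - real l))\<^sup>2) - matern_mix \<nu> A2 ((r * (real k - real l))\<^sup>2)))
       \<ge> \<delta> * r powr (2 * \<nu> + 2)" (is "?L \<ge> _") if r: "0 < r" "r \<le> 1" for r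
  proof -
    let ?\<psi> = "\<lambda>w. \<Sum>k\<le>p. \<Sum>l\<le>p. a k * a l * exp (- ((real k - real l)\<^sup>2 / (4 * w)))"
    let ?g = "\<lambda>A k l v. indicator {0<..} v * (v powr (\<nu> - 1) * exp (- (A * v)) * exp (- ((r * (real k - real l))\<^sup>2 / (4 * v))))"
    let ?h = "\<lambda>v. \<Sum>k\<le>p. \<Sum>l\<le>p. a k * a l * (?g A1 k l v - ?g A2 k l v)"
    have gi: "integrable lborel (?g B k l)" if "B > 0" for B k l
      by (rule integrable_matern_mix) (use nu that in auto)
    have hi: "integrable lborel ?h"
      using A by (intro Bochner_Integration.integrable_sum integrable_mult_right Bochner_Integration.integrable_diff gi) auto
    have L: "?L = (\<integral>v. ?h v \<partial>lborel)"
      unfolding matern_mix_def using gi A by (simp add: Bochner_Integration.integral_sum)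
    have h: "?h v = indicator {0<..} v * (v powr (\<nu> - 1) * (exp (- (A1 * v)) - exp (- (A2 * v))) * ?\<psi> (v / r\<^sup>2))" for v
    proof -
      have "(r * (real k - real l))\<^sup>2 / (4 * v) = (real k - real l)\<^sup>2 / (4 * (v / r\<^sup>2))" for k l
        using r by (simp add: power_mult_distrib)
      note eq = this
      show ?thesis
        unfolding eq sum_distrib_left
        by (intro sum.cong refl) (simp add: left_diff_distrib right_diff_distrib mult_ac)
    qed
    let ?c = "w0 * r\<^sup>2"
    have c: "?c > 0" "?c \<le> w0" using r w0 by (auto simp: mult_le_cancel_left1 power_le_one)
    let ?low = "\<lambda>v. indicator {0..?c} v * v powr \<nu>"
    have "((\<lambda>v. v powr \<nu>) has_integral (?c powr (\<nu> + 1) / (\<nu> + 1))) {0..?c}"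
      using nu c by (intro has_integral_powr_from_0) auto
    then have si: "set_integrable lebesgue {0..?c} (\<lambda>v. v powr \<nu>)"
      and iv: "integral {0..?c} (\<lambda>v. v powr \<nu>) = ?c powr (\<nu> + 1) / (\<nu> + 1)"
      by (auto intro!: nonnegative_absolutely_integrable_1 simp: integral_unique has_integral_integrable)
    have li: "integrable lborel ?low"
      using si unfolding set_integrable_def by (subst (asm) integrable_completion) auto
    have "(\<integral>v. ?low v \<partial>lborel) = (LINT v:{0..?c}|lborel. v powr \<nu>)"
      by (simp add: set_lebesgue_integral_def)
    also have "\<dots> = ?c powr (\<nu> + 1) / (\<nu> + 1)"
      unfolding iv[symmetric] using li by (intro set_borel_integral_eq_integral) (simp add: set_integrable_def)
    finally have lv: "(\<integral>v. ?low v \<partial>lborel) = ?c powr (\<nu> + 1) / (\<nu> + 1)" .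
    have pw: "\<kappa> * \<psi>0 * ?low v \<le> ?h v" for v
    proof (cases "v > 0")
      case True
      have d: "exp (- (A1 * v)) - exp (- (A2 * v)) \<ge> 0" using A True by simp
      have psd: "?\<psi> (v / r\<^sup>2) \<ge> 0" using True r by (intro gaussian_kernel_psd) auto
      show ?thesis
      proof (cases "v \<le> ?c")
        case le: True
        have "(A2 - A1) * v * exp (- (A2 * w0)) \<le> (exp ((A2 - A1) * v) - 1) * exp (- (A2 * v))"
        proof (rule mult_mono)
          show "(A2 - A1) * v \<le> exp ((A2 - A1) * v) - 1" using exp_ge_add_one_self[of "(A2 - A1) * v"] by linarith
          show "exp (- (A2 * w0)) \<le> exp (- (A2 * v))" using A le c by simp
        qed (use A True in auto)
        also have "\<dots> = exp (- (A1 * v)) - exp (- (A2 * v))"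
          by (simp add: left_diff_distrib flip: exp_add)
        finally have "\<kappa> * v \<le> exp (- (A1 * v)) - exp (- (A2 * v))" by (simp add: \<kappa>_def mult_ac)
        moreover have "\<psi>0 \<le> ?\<psi> (v / r\<^sup>2)"
          using le True r by (intro low) (auto simp: divide_le_eq)
        ultimately have "v powr (\<nu> - 1) * (\<kappa> * v) * \<psi>0 \<le> v powr (\<nu> - 1) * (exp (- (A1 * v)) - exp (- (A2 * v))) * ?\<psi> (v / r\<^sup>2)"
          using True w0 \<kappa> d by (intro mult_mono mult_left_mono) auto
        then show ?thesis unfolding h using True le by (simp add: powr_diff field_simps)
      next
        case False
        then show ?thesis unfolding h using True d psd by simp
      qed
    next
      case False
      then show ?thesis unfolding h using nu by (cases "v = 0") auto
    qed
    have "\<delta> * r powr (2 * \<nu> + 2) = \<kappa> * \<psi>0 * (?c powr (\<nu> + 1) / (\<nu> + 1))"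
    proof -
      have "(r\<^sup>2) powr (\<nu> + 1) = r powr (2 * \<nu> + 2)"
        using r by (simp add: powr_powr distrib_left flip: powr_numeral)
      then show ?thesis using r w0 by (simp add: \<delta>_def powr_mult)
    qed
    also have "\<dots> = (\<integral>v. \<kappa> * \<psi>0 * ?low v \<partial>lborel)" using lv by simp
    also have "\<dots> \<le> (\<integral>v. ?h v \<partial>lborel)"
      using li hi pw by (intro integral_mono) auto
    also have "\<dots> = ?L" by (rule L[symmetric])
    finally show ?thesis .
  qed
  with \<delta> show ?thesis by blast
qed

section \<open>Separation by quadratic forms of finitely many path values\<close>

definition quad_form :: "'i set \<Rightarrow> ('i \<Rightarrow> real) \<Rightarrow> nat \<Rightarrow> (nat \<Rightarrow> real) \<Rightarrow> ('i \<Rightarrow> nat \<Rightarrow> 'a) \<Rightarrow> ('a \<Rightarrow> real) \<Rightarrow> real" where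
  "quad_form I w p a pt f = (\<Sum>i\<in>I. w i * (\<Sum>k\<le>p. a k * f (pt i k))\<^sup>2)"

lemma path_law_quad_form_deviation:
  fixes pt :: "'i \<Rightarrow> nat \<Rightarrow> 'a::topological_space" and w :: "'i \<Rightarrow> real"
  assumes cg: "centered_gaussian_field M Y" and P: "is_path_law M Y K P" and K: "compact K"
    and I: "finite I" "\<And>i k. i \<in> I \<Longrightarrow> k \<le> p \<Longrightarrow> pt i k \<in> K"
    and "\<epsilon> > 0" and B: "B \<in> sets borel"
    and dev: "\<And>q. q \<in> B \<Longrightarrow> \<bar>q - (\<Sum>i\<in>I. w i * (\<integral>\<omega>. (\<Sum>k\<le>p. a k * Y (pt i k) \<omega>)\<^sup>2 \<partial>M))\<bar> \<ge> \<epsilon>"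
  shows "measure P (quad_form I w p a pt -` B \<inter> space P) \<le>
    2 * (\<Sum>i\<in>I. \<Sum>j\<in>I. w i * w j *
      (\<integral>\<omega>. (\<Sum>k\<le>p. a k * Y (pt i k) \<omega>) * (\<Sum>k\<le>p. a k * Y (pt j k) \<omega>) \<partial>M)\<^sup>2) / \<epsilon>\<^sup>2"
proof -
  interpret centered_gaussian_field M Y by fact
  let ?T = "(\<lambda>(i, k). pt i k) ` (I \<times> {..p})"
  have "measure P (quad_form I w p a pt -` B \<inter> space P) =
      prob {\<omega>\<in>space M. quad_form I w p a pt (\<lambda>t. Y t \<omega>) \<in> B}"
  proof (rule is_path_law_finite_dim[OF P _ _ K prob_space_axioms, of ?T])
    show "quad_form I w p a pt f = quad_form I w p a pt g" if "\<And>t. t \<in> ?T \<Longrightarrow> f t = g t" for f g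
    proof -
      have "f (pt i k) = g (pt i k)" if "i \<in> I" "k \<in> {..p}" for i k
        using that \<open>\<And>t. t \<in> ?T \<Longrightarrow> f t = g t\<close> by (metis (mono_tags, lifting) SigmaI case_prod_conv image_eqI)
      then show ?thesis by (simp add: quad_form_def)
    qed
    show "quad_form I w p a pt \<in> borel_measurable (C_borel K)"
      unfolding quad_form_def using I
      by (intro borel_measurable_sum borel_measurable_times borel_measurable_power
          measurable_C_borel_eval[OF K]) auto
    show "(\<lambda>\<omega>. quad_form I w p a pt (\<lambda>t. Y t \<omega>)) \<in> borel_measurable M"
      unfolding quad_form_def
      by (intro borel_measurable_sum borel_measurable_times borel_measurable_power
          span_gaussian(1)[OF field_span_base]) auto
  qed (use I B in auto)
  also have "\<dots> \<le> prob {\<omega>\<in>space M. \<bar>(\<Sum>i\<in>I. w i * (\<Sum>k\<le>p. a k * Y (pt i k) \<omega>)\<^sup>2)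
      - (\<Sum>i\<in>I. w i * (\<integral>\<omega>. (\<Sum>k\<le>p. a k * Y (pt i k) \<omega>)\<^sup>2 \<partial>M))\<bar> \<ge> \<epsilon>}"
  proof (rule finite_measure_mono)
    have [measurable]: "Y t \<in> borel_measurable M" for t by (rule span_gaussian(1)[OF field_span_base])
    show "{\<omega>\<in>space M. \<bar>(\<Sum>i\<in>I. w i * (\<Sum>k\<le>p. a k * Y (pt i k) \<omega>)\<^sup>2)
      - (\<Sum>i\<in>I. w i * (\<integral>\<omega>. (\<Sum>k\<le>p. a k * Y (pt i k) \<omega>)\<^sup>2 \<partial>M))\<bar> \<ge> \<epsilon>} \<in> events" by measurable
  qed (use dev in \<open>auto simp: quad_form_def\<close>)
  also have "\<dots> \<le> 2 * (\<Sum>i\<in>I. \<Sum>j\<in>I. w i * w j *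
      (\<integral>\<omega>. (\<Sum>k\<le>p. a k * Y (pt i k) \<omega>) * (\<Sum>k\<le>p. a k * Y (pt j k) \<omega>) \<partial>M)\<^sup>2) / \<epsilon>\<^sup>2"
    by (rule quadratic_form_deviation[OF I(1) stencil_in_span \<open>\<epsilon> > 0\<close>])
  finally show ?thesis .
qed

text \<open>
  Gap of the expectations and variance both grow linearly in \<open>J\<close>. The threshold halfway between
  the two expectations then misclassifies with probability \<open>O(1 / J)\<close> under either law.
\<close>
lemma path_laws_singular_if_quad_forms_separate:
  fixes Y1 :: "'a::topological_space \<Rightarrow> 'w1 \<Rightarrow> real" and Y2 :: "'a \<Rightarrow> 'w2 \<Rightarrow> real"
    and I :: "nat \<Rightarrow> 'i set" and p :: nat
  assumes cg1: "centered_gaussian_field M1 Y1" and cg2: "centered_gaussian_field M2 Y2"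
    and P1: "is_path_law M1 Y1 K P1" and P2: "is_path_law M2 Y2 K P2" and K: "compact K"
    and I: "\<And>J. finite (I J)" "\<And>J i k. i \<in> I J \<Longrightarrow> k \<le> p \<Longrightarrow> pt i k \<in> K"
    and gap: "h > 0" "\<And>J. (\<Sum>i\<in>I J. w i * (\<integral>\<omega>. (\<Sum>k\<le>p. a k * Y1 (pt i k) \<omega>)\<^sup>2 \<partial>M1))
        - (\<Sum>i\<in>I J. w i * (\<integral>\<omega>. (\<Sum>k\<le>p. a k * Y2 (pt i k) \<omega>)\<^sup>2 \<partial>M2)) \<ge> h * real J"
    and var1: "\<And>J. (\<Sum>i\<in>I J. \<Sum>j\<in>I J. w i * w j *
      (\<integral>\<omega>. (\<Sum>k\<le>p. a k * Y1 (pt i k) \<omega>) * (\<Sum>k\<le>p. a k * Y1 (pt j k) \<omega>) \<partial>M1)\<^sup>2) \<le> H * real J"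
    and var2: "\<And>J. (\<Sum>i\<in>I J. \<Sum>j\<in>I J. w i * w j *
      (\<integral>\<omega>. (\<Sum>k\<le>p. a k * Y2 (pt i k) \<omega>) * (\<Sum>k\<le>p. a k * Y2 (pt j k) \<omega>) \<partial>M2)\<^sup>2) \<le> H * real J"
  shows "mutually_singular P1 P2"
proof (rule mutually_singular_if_separating_events)
  interpret F1: centered_gaussian_field M1 Y1 by fact
  interpret F2: centered_gaussian_field M2 Y2 by fact
  show "prob_space P1" "prob_space P2" "sets P1 = sets P2"
    using is_path_law_prob_space[OF F1.prob_space_axioms P1] is_path_law_prob_space[OF F2.prob_space_axioms P2] by auto
  fix \<epsilon> :: real assume \<epsilon>: "\<epsilon> > 0"
  obtain J :: nat where J: "real J > \<bar>8 * H\<bar> / (h\<^sup>2 * \<epsilon>)" using reals_Archimedean2 by blast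
  moreover have "\<bar>8 * H\<bar> / (h\<^sup>2 * \<epsilon>) \<ge> 0" using \<epsilon> by simp
  ultimately have J0: "real J > 0" by linarith
  define Q where "Q = quad_form (I J) w p a pt"
  define m1 m2 where "m1 = (\<Sum>i\<in>I J. w i * (\<integral>\<omega>. (\<Sum>k\<le>p. a k * Y1 (pt i k) \<omega>)\<^sup>2 \<partial>M1))"
    and "m2 = (\<Sum>i\<in>I J. w i * (\<integral>\<omega>. (\<Sum>k\<le>p. a k * Y2 (pt i k) \<omega>)\<^sup>2 \<partial>M2))"
  have g: "m1 - m2 \<ge> h * real J" using gap(2) by (simp add: m1_def m2_def)
  define d where "d = h * real J / 2"
  have d: "d > 0" using gap(1) J0 by (simp add: d_def)
  have small: "2 * v / d\<^sup>2 \<le> \<epsilon>" if "v \<le> H * real J" for v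
  proof -
    have "8 * H \<le> real J * (h\<^sup>2 * \<epsilon>)"
      using J \<epsilon> gap(1) by (simp add: divide_less_eq)
    then have "8 * H * real J \<le> real J * (h\<^sup>2 * \<epsilon>) * real J" using J0 by (intro mult_right_mono) auto
    then have "2 * (H * real J) \<le> \<epsilon> * d\<^sup>2" by (simp add: d_def power2_eq_square algebra_simps)
    then have "2 * v \<le> \<epsilon> * d\<^sup>2" using that by linarith
    then show ?thesis using d by (simp add: divide_le_eq)
  qed
  let ?A = "Q -` {..(m1 + m2) / 2} \<inter> space P1"
  have Qm: "Q \<in> borel_measurable (C_borel K)"
    unfolding Q_def quad_form_def using I
    by (intro borel_measurable_sum borel_measurable_times borel_measurable_power
        measurable_C_borel_eval[OF K]) auto
  have sP: "sets P1 = sets (C_borel K)" "space P1 = space (C_borel K)" "space P2 = space (C_borel K)"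
    using is_path_law_prob_space[OF F1.prob_space_axioms P1] is_path_law_prob_space[OF F2.prob_space_axioms P2]
    by (auto dest: sets_eq_imp_space_eq)
  have "measure P1 ?A \<le> \<epsilon>"
    unfolding Q_def
    by (rule order_trans[OF path_law_quad_form_deviation[OF cg1 P1 K I(1) I(2) d] small[OF var1]])
       (use g d in \<open>auto simp: d_def m1_def[symmetric] abs_if field_simps\<close>)
  moreover have "space P2 - ?A = Q -` {(m1 + m2) / 2<..} \<inter> space P2" using sP by auto
  moreover have "measure P2 (Q -` {(m1 + m2) / 2<..} \<inter> space P2) \<le> \<epsilon>"
    unfolding Q_def
    by (rule order_trans[OF path_law_quad_form_deviation[OF cg2 P2 K I(1) I(2) d] small[OF var2]])
       (use g d in \<open>auto simp: d_def m2_def[symmetric] abs_if field_simps\<close>)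
  moreover have "?A \<in> sets P1" unfolding sP using Qm by (rule measurable_sets) simp
  ultimately show "\<exists>A\<in>sets P1. measure P1 A \<le> \<epsilon> \<and> measure P2 (space P2 - A) \<le> \<epsilon>"
    by (intro bexI[of _ ?A]) auto
qed

text \<open>
  The functionals of spacing \<open>r\<close> are indexed by the grid; the fixed functional they are compared with has the same
  coefficients but arbitrary points \<open>s k\<close>, so it may live on a different scale. The Cauchy-Schwarz
  inequality over these points reduces the claim to the stencil acting on the covariance with one
  value of the field.
\<close>
lemma stencil_covariance_sum_bound:
  fixes c :: "'n::finite" and a :: "nat \<Rightarrow> real"
  assumes st: "\<And>A r (x :: real ^ 'n). A > 0 \<Longrightarrow> r > 0 \<Longrightarrow>
        (\<Sum>k\<le>p. a k * matern_mix \<nu> A ((norm (x + (r * real k) *\<^sub>R axis c 1))\<^sup>2))\<^sup>2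
        \<le> C * r powr (4 * \<nu>) * lattice_weight (x /\<^sub>R r)"
    and lw: "\<And>(y :: real ^ 'n) n. (\<Sum>i\<in>cube_grid n. lattice_weight (y + (\<chi> c. real (i c)))) \<le> B"
    and C: "C > 0" and A: "A > 0" and r: "r > 0"
  shows "(\<Sum>i\<in>cube_grid n. (\<Sum>k\<le>p. \<Sum>l\<le>p. a k * a l *
      matern_mix \<nu> A ((norm (x0 + r *\<^sub>R (\<chi> c. real (i c)) + (r * real l) *\<^sub>R axis c 1 - s k))\<^sup>2))\<^sup>2)
     \<le> (\<Sum>k\<le>p. (a k)\<^sup>2) * (real p + 1) * C * B * r powr (4 * \<nu>)"
proof -
  define g where "g i k = (\<Sum>l\<le>p. a l * matern_mix \<nu> A ((norm (x0 + r *\<^sub>R (\<chi> c. real (i c)) + (r * real l) *\<^sub>R axis c 1 - s k))\<^sup>2))"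
    for i :: "'n \<Rightarrow> nat" and k
  have gb: "(\<Sum>i\<in>cube_grid n. (g i k)\<^sup>2) \<le> C * r powr (4 * \<nu>) * B" for k
  proof -
    have "(g i k)\<^sup>2 \<le> C * r powr (4 * \<nu>) * lattice_weight ((x0 - s k) /\<^sub>R r + (\<chi> c. real (i c)))" for i
    proof -
      have "(x0 + r *\<^sub>R (\<chi> c. real (i c)) - s k) /\<^sub>R r = (x0 - s k) /\<^sub>R r + (\<chi> c. real (i c))"
        using r by (simp add: scaleR_diff_right scaleR_add_right)
      then show ?thesis
        using st[OF A r, of "x0 + r *\<^sub>R (\<chi> c. real (i c)) - s k"] by (simp add: g_def add_diff_eq diff_add_eq)
    qed
    then have "(\<Sum>i\<in>cube_grid n. (g i k)\<^sup>2) \<le> (\<Sum>i\<in>cube_grid n. C * r powr (4 * \<nu>) * lattice_weight ((x0 - s k) /\<^sub>R r + (\<chi> c. real (i c))))"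
      by (intro sum_mono)
    also have "\<dots> \<le> C * r powr (4 * \<nu>) * B"
      unfolding sum_distrib_left[symmetric] using C by (intro mult_left_mono lw) auto
    finally show ?thesis .
  qed
  have "(\<Sum>k\<le>p. \<Sum>l\<le>p. a k * a l *
      matern_mix \<nu> A ((norm (x0 + r *\<^sub>R (\<chi> c. real (i c)) + (r * real l) *\<^sub>R axis c 1 - s k))\<^sup>2)) = (\<Sum>k\<le>p. a k * g i k)" for i
    by (simp add: g_def sum_distrib_left mult.assoc)
  then have "(\<Sum>i\<in>cube_grid n. (\<Sum>k\<le>p. \<Sum>l\<le>p. a k * a l *
      matern_mix \<nu> A ((norm (x0 + r *\<^sub>R (\<chi> c. real (i c)) + (r * real l) *\<^sub>R axis c 1 - s k))\<^sup>2))\<^sup>2)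
    = (\<Sum>i\<in>cube_grid n. (\<Sum>k\<le>p. a k * g i k)\<^sup>2)" by (simp only:)
  also have "\<dots> \<le> (\<Sum>i\<in>cube_grid n. (\<Sum>k\<le>p. (a k)\<^sup>2) * (\<Sum>k\<le>p. (g i k)\<^sup>2))"
    by (intro sum_mono Cauchy_Schwarz_ineq_sum)
  also have "\<dots> = (\<Sum>k\<le>p. (a k)\<^sup>2) * (\<Sum>k\<le>p. \<Sum>i\<in>cube_grid n. (g i k)\<^sup>2)"
    unfolding sum_distrib_left[symmetric] by (subst sum.swap) simp
  also have "\<dots> \<le> (\<Sum>k\<le>p. (a k)\<^sup>2) * (\<Sum>k\<le>p. C * r powr (4 * \<nu>) * B)"
    by (intro mult_left_mono sum_mono gb sum_nonneg) auto
  finally show ?thesis by (simp add: mult_ac add_ac)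
qed

text \<open>
  With truncated subtraction, \<open>(i - j) + (j - i)\<close> is the distance of \<open>i\<close> and \<open>j\<close>.
\<close>
lemma sum_geometric_distance:
  fixes F :: "nat set"
  assumes "finite F"
  shows "(\<Sum>j\<in>F. (1/2 :: real) ^ ((i - j) + (j - i))) \<le> 4"
proof -
  have geo: "sum (\<lambda>l. (1/2 :: real) ^ l) G \<le> 2" if "finite G" for G :: "nat set"
    using sum_le_suminf[OF summable_geometric[of "1/2::real"] that] suminf_geometric[of "1/2::real"] by simp
  let ?A = "{j\<in>F. i \<le> j}" and ?B = "{j\<in>F. j < i}"
  have "(\<Sum>j\<in>?A. (1/2 :: real) ^ ((i - j) + (j - i))) = sum (\<lambda>l. (1/2) ^ l) ((\<lambda>j. j - i) ` ?A)"
    by (subst sum.reindex) (auto intro!: inj_onI sum.cong)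
  also have "\<dots> \<le> 2" using assms by (intro geo) auto
  finally have A: "(\<Sum>j\<in>?A. (1/2 :: real) ^ ((i - j) + (j - i))) \<le> 2" .
  have "(\<Sum>j\<in>?B. (1/2 :: real) ^ ((i - j) + (j - i))) = sum (\<lambda>l. (1/2) ^ l) ((\<lambda>j. i - j) ` ?B)"
    by (subst sum.reindex) (auto intro!: inj_onI sum.cong)
  also have "\<dots> \<le> 2" using assms by (intro geo) auto
  finally have B: "(\<Sum>j\<in>?B. (1/2 :: real) ^ ((i - j) + (j - i))) \<le> 2" .
  have "(\<Sum>j\<in>F. (1/2 :: real) ^ ((i - j) + (j - i))) = (\<Sum>j\<in>?A \<union> ?B. (1/2 :: real) ^ ((i - j) + (j - i)))"
    by (intro sum.cong) auto
  also have "\<dots> = (\<Sum>j\<in>?A. (1/2 :: real) ^ ((i - j) + (j - i))) + (\<Sum>j\<in>?B. (1/2 :: real) ^ ((i - j) + (j - i)))"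
    using assms by (intro sum.union_disjoint) auto
  finally show ?thesis using A B by linarith
qed

section \<open>The multiscale statistic in dimension four\<close>

text \<open>
  The side \<open>L\<close> is kept below 1 so that all grid spacings are in the range \<open>r \<le> 1\<close> of
  \<open>matern_mix_stencil_gap\<close>; the factor 2 leaves room for the extent of the stencils.
\<close>
lemma interior_contains_cube:
  fixes D :: "(real ^ 'n) set"
  assumes "interior D \<noteq> {}"
  shows "\<exists>x0 L. 0 < L \<and> L \<le> 1 \<and> (\<forall>y. (\<forall>c. 0 \<le> (y - x0) $ c \<and> (y - x0) $ c \<le> 2 * L) \<longrightarrow> y \<in> D)"
proof -
  obtain x0 e where e: "e > 0" "ball x0 e \<subseteq> D" using assms mem_interior by blast
  define L where "L = min 1 (e / (4 * CARD('n)))"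
  have L: "0 < L" "L \<le> 1" using e by (auto simp: L_def)
  have "y \<in> D" if y: "\<forall>c. 0 \<le> (y - x0) $ c \<and> (y - x0) $ c \<le> 2 * L" for y
  proof -
    have "norm (y - x0) \<le> (\<Sum>c\<in>UNIV. \<bar>(y - x0) $ c\<bar>)" by (rule norm_le_l1_cart)
    also have "\<dots> \<le> (\<Sum>c\<in>(UNIV::'n set). 2 * L)" using y by (intro sum_mono) (simp add: abs_of_nonneg del: vector_minus_component)
    also have "\<dots> = CARD('n) * (2 * L)" by simp
    also have "\<dots> \<le> CARD('n) * (2 * (e / (4 * CARD('n))))" by (intro mult_left_mono) (auto simp: L_def)
    also have "\<dots> < e" using e by simp
    finally show "y \<in> D" using e by (auto simp: dist_norm norm_minus_commute)
  qed
  with L show ?thesis by blast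
qed

definition grid_spacing :: "real \<Rightarrow> nat \<Rightarrow> real" where
  "grid_spacing L j = L / 2 ^ j"

definition stencil_point :: "real ^ 4 \<Rightarrow> real \<Rightarrow> nat \<times> (4 \<Rightarrow> nat) \<Rightarrow> nat \<Rightarrow> real ^ 4" where
  "stencil_point x0 L = (\<lambda>(j, i) k. x0 + grid_spacing L j *\<^sub>R (\<chi> c. real (i c)) + (grid_spacing L j * real k) *\<^sub>R axis 1 1)"

text \<open>
  Scales start at \<open>p\<close>, where \<open>2 ^ p > p\<close>: from then on a stencil of \<open>p + 1\<close> points has extent at
  most \<open>L\<close>, and one that starts in the cube of side \<open>L\<close> stays in the cube of side \<open>2 * L\<close>.
\<close>
definition multiscale_index :: "nat \<Rightarrow> nat \<Rightarrow> (nat \<times> (4 \<Rightarrow> nat)) set" where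
  "multiscale_index p J = (SIGMA j:{p..<p + J}. cube_grid (2 ^ j))"

text \<open>
  The normalisation under which every scale contributes equally. For spacing \<open>r\<close> there are
  \<open>(L / r)^4\<close> functionals, with variances of order \<open>r powr (2 * \<nu>)\<close> and variance gaps of order
  \<open>r powr (2 * \<nu> + 2)\<close>.
\<close>
definition scale_weight :: "real \<Rightarrow> real \<Rightarrow> nat \<times> (4 \<Rightarrow> nat) \<Rightarrow> real" where
  "scale_weight \<nu> L = (\<lambda>(j, i). grid_spacing L j powr (2 - 2 * \<nu>))"

lemma grid_spacing_pos: "L > 0 \<Longrightarrow> grid_spacing L j > 0"
  by (simp add: grid_spacing_def)

lemma finite_multiscale_index: "finite (multiscale_index p J)"
  unfolding multiscale_index_def by (intro finite_SigmaI) auto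

lemma sum_multiscale_index:
  fixes f :: "nat \<times> (4 \<Rightarrow> nat) \<Rightarrow> real"
  shows "(\<Sum>i\<in>multiscale_index p J. f i) = (\<Sum>j\<in>{p..<p + J}. \<Sum>i\<in>cube_grid (2 ^ j). f (j, i))"
  unfolding multiscale_index_def by (simp add: sum.Sigma)

lemma stencil_point_in_cube:
  assumes L: "L > 0" and i: "i \<in> multiscale_index p J" and k: "k \<le> p"
  shows "0 \<le> (stencil_point x0 L i k - x0) $ c \<and> (stencil_point x0 L i k - x0) $ c \<le> 2 * L"
proof -
  obtain j g where jg: "i = (j, g)" "p \<le> j" "g \<in> cube_grid (2 ^ j)"
    using i by (auto simp: multiscale_index_def)
  have "g c < 2 ^ j" using cube_gridD[OF jg(3)] .
  then have "real (g c) \<le> 2 ^ j" by (metis less_imp_le of_nat_le_iff of_nat_numeral of_nat_power)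
  then have 1: "grid_spacing L j * real (g c) \<le> L"
    using L by (simp add: grid_spacing_def divide_le_eq mult_left_mono)
  have "k < 2 ^ j" using k jg(2) less_exp[of j] by linarith
  then have "real k \<le> 2 ^ j" by (metis less_imp_le of_nat_le_iff of_nat_numeral of_nat_power)
  then have 2: "grid_spacing L j * real k \<le> L"
    using L by (simp add: grid_spacing_def divide_le_eq mult_left_mono)
  show ?thesis
    using 1 2 L grid_spacing_pos[OF L, of j] by (auto simp: jg(1) stencil_point_def axis_def)
qed

text \<open>
  The bound \<open>r' powr (4 * \<nu>)\<close> on the squared covariances with one coarse functional, summed over the
  \<open>(L / r)^4\<close> coarse functionals and multiplied by both weights, is \<open>L^4 * (r' / r) powr (2 + 2 * \<nu>)\<close>.
  The interaction of two scales thus decays geometrically in the distance of their exponents.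
\<close>
lemma scale_product_decay:
  assumes L: "L > 0" and nu: "\<nu> > 0" and "j \<le> j'"
  shows "grid_spacing L j powr (2 - 2 * \<nu>) * grid_spacing L j' powr (2 - 2 * \<nu>) * ((2 ^ j) ^ 4 * grid_spacing L j' powr (4 * \<nu>))
    \<le> L ^ 4 * (1/2) ^ (j' - j)"
proof -
  define r r' where "r = grid_spacing L j" and "r' = grid_spacing L j'"
  have r: "r > 0" "r' > 0" using L by (auto simp: r_def r'_def grid_spacing_pos)
  have q: "r' / r = (1/2) ^ (j' - j)"
  proof -
    have "(2::real) ^ j' = 2 ^ j * 2 ^ (j' - j)" using assms(3) by (simp flip: power_add)
    then show ?thesis using L by (simp add: r_def r'_def grid_spacing_def power_one_over)
  qed
  have n: "(2 ^ j) ^ 4 = L ^ 4 * r powr (- 4)"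
  proof -
    have "r powr (-4) = 1 / r ^ 4" using r by (simp add: powr_minus powr_numeral divide_inverse)
    then show ?thesis using L by (simp add: r_def grid_spacing_def power_divide)
  qed
  have "r powr (2 - 2 * \<nu>) * r' powr (2 - 2 * \<nu>) * ((2 ^ j) ^ 4 * r' powr (4 * \<nu>))
     = L ^ 4 * ((r powr (2 - 2 * \<nu>) * r powr (- 4)) * (r' powr (2 - 2 * \<nu>) * r' powr (4 * \<nu>)))"
    unfolding n by (simp add: mult_ac)
  also have "r powr (2 - 2 * \<nu>) * r powr (- 4) = r powr (- (2 + 2 * \<nu>))" by (simp flip: powr_add)
  also have "r' powr (2 - 2 * \<nu>) * r' powr (4 * \<nu>) = r' powr (2 + 2 * \<nu>)" by (simp add: add.commute flip: powr_add)
  also have "r powr (- (2 + 2 * \<nu>)) * r' powr (2 + 2 * \<nu>) = (r' / r) powr (2 + 2 * \<nu>)"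
    unfolding powr_minus_divide using r by (simp add: powr_divide)
  \<comment> \<open>any positive exponent would do; 1 gives the ratio of the dyadic spacings itself\<close>
  also have "(r' / r) powr (2 + 2 * \<nu>) \<le> (r' / r) powr 1"
    unfolding q using nu by (intro powr_mono') (auto simp: power_le_one)
  also have "(r' / r) powr 1 = (1/2) ^ (j' - j)" using r unfolding q by simp
  finally show ?thesis using L by (simp add: r_def r'_def)
qed

text \<open>
  For each pair of scales \<open>stencil_covariance_sum_bound\<close> is applied with the finer scale
  summed first, as the bound improves with the finer spacing. The geometric decay in the distance of
  the scales makes the double sum linear in \<open>J\<close>.
\<close>
lemma multiscale_covariance_sum_bound:
  fixes a :: "nat \<Rightarrow> real"
  assumes st: "\<And>A r (x :: real ^ 4). A > 0 \<Longrightarrow> r > 0 \<Longrightarrow>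
        (\<Sum>k\<le>p. a k * matern_mix \<nu> A ((norm (x + (r * real k) *\<^sub>R axis 1 1))\<^sup>2))\<^sup>2
        \<le> C * r powr (4 * \<nu>) * lattice_weight (x /\<^sub>R r)"
    and lw: "\<And>(y :: real ^ 4) n. (\<Sum>i\<in>cube_grid n. lattice_weight (y + (\<chi> c. real (i c)))) \<le> B"
    and C: "C > 0" and B: "B > 0" and A: "A > 0" and nu: "\<nu> > 0" and L: "L > 0"
  shows "(\<Sum>i\<in>multiscale_index p J. \<Sum>i'\<in>multiscale_index p J. scale_weight \<nu> L i * scale_weight \<nu> L i' *
      (\<Sum>k\<le>p. \<Sum>l\<le>p. a k * a l * matern_mix \<nu> A ((norm (stencil_point x0 L i' l - stencil_point x0 L i k))\<^sup>2))\<^sup>2)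
    \<le> 4 * L ^ 4 * ((\<Sum>k\<le>p. (a k)\<^sup>2) * (real p + 1) * C * B) * real J"
proof -
  define G where "G = (\<Sum>k\<le>p. (a k)\<^sup>2) * (real p + 1) * C * B"
  have G: "G \<ge> 0" unfolding G_def using C B by (auto intro!: mult_nonneg_nonneg sum_nonneg)
  define V where "V i i' = (\<Sum>k\<le>p. \<Sum>l\<le>p. a k * a l *
      matern_mix \<nu> A ((norm (stencil_point x0 L i' l - stencil_point x0 L i k))\<^sup>2))\<^sup>2" for i i'
  have sym: "V i i' = V i' i" for i i'
    unfolding V_def by (subst sum.swap) (simp add: norm_minus_commute mult.commute)
  define g where "g j = (cube_grid (2 ^ j) :: (4 \<Rightarrow> nat) set)" for j
  define U where "U j j' = (\<Sum>i\<in>g j. \<Sum>i'\<in>g j'. V (j, i) (j', i'))" for j j'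
  have symU: "U j j' = U j' j" for j j'
    unfolding U_def by (subst sum.swap) (simp add: sym)
  have U: "U j j' \<le> (2 ^ j) ^ 4 * (G * grid_spacing L j' powr (4 * \<nu>))" for j j'
  proof -
    have "(\<Sum>i'\<in>g j'. V (j, i) (j', i')) \<le> G * grid_spacing L j' powr (4 * \<nu>)" for i
      using stencil_covariance_sum_bound[OF st lw C A grid_spacing_pos[OF L, of j'],
          where n = "2 ^ j'" and ?x0.0 = x0 and s = "stencil_point x0 L (j, i)"]
      by (simp add: V_def G_def g_def stencil_point_def)
    then have "U j j' \<le> (\<Sum>i\<in>g j. G * grid_spacing L j' powr (4 * \<nu>))"
      unfolding U_def by (intro sum_mono)
    then show ?thesis by (simp add: g_def card_cube_grid)
  qed
  let ?w = "\<lambda>j. grid_spacing L j powr (2 - 2 * \<nu>)"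
  have le: "?w j * ?w j' * U j j' \<le> G * L ^ 4 * (1/2) ^ ((j - j') + (j' - j))" for j j'
  proof -
    \<comment> \<open>the finer scale comes second: the bound on \<open>U\<close> sums over the second index first\<close>
    have ord: "?w j * ?w j' * U j j' \<le> G * L ^ 4 * (1/2) ^ (j' - j)" if "j \<le> j'" for j j'
    proof -
      have "?w j * ?w j' * U j j' \<le> ?w j * ?w j' * ((2 ^ j) ^ 4 * (G * grid_spacing L j' powr (4 * \<nu>)))"
        by (intro mult_left_mono U) auto
      also have "\<dots> = G * (?w j * ?w j' * ((2 ^ j) ^ 4 * grid_spacing L j' powr (4 * \<nu>)))"
        by (simp add: mult_ac)
      also have "\<dots> \<le> G * (L ^ 4 * (1/2) ^ (j' - j))"
        by (intro mult_left_mono G scale_product_decay L nu that)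
      finally show ?thesis by (simp add: mult_ac)
    qed
    show ?thesis
    proof (cases "j \<le> j'")
      case True
      then show ?thesis using ord[OF True] by simp
    next
      case False
      then show ?thesis using ord[of j' j] symU[of j j'] by (simp add: mult.commute)
    qed
  qed
  have "(\<Sum>i\<in>multiscale_index p J. \<Sum>i'\<in>multiscale_index p J. scale_weight \<nu> L i * scale_weight \<nu> L i' * V i i')
    = (\<Sum>j\<in>{p..<p+J}. \<Sum>i\<in>g j. \<Sum>j'\<in>{p..<p+J}. \<Sum>i'\<in>g j'. ?w j * ?w j' * V (j, i) (j', i'))"
    unfolding sum_multiscale_index g_def by (simp add: scale_weight_def)
  also have "\<dots> = (\<Sum>j\<in>{p..<p+J}. \<Sum>j'\<in>{p..<p+J}. ?w j * ?w j' * U j j')"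
    unfolding U_def sum_distrib_left by (intro sum.cong refl) (subst sum.swap, simp)
  also have "\<dots> \<le> (\<Sum>j\<in>{p..<p+J}. \<Sum>j'\<in>{p..<p+J}. G * L ^ 4 * (1/2) ^ ((j - j') + (j' - j)))"
    by (intro sum_mono le)
  also have "\<dots> \<le> (\<Sum>j\<in>{p..<p+J}. G * L ^ 4 * 4)"
    unfolding sum_distrib_left[symmetric] using G L
    by (intro sum_mono mult_left_mono sum_geometric_distance) auto
  also have "\<dots> = 4 * L ^ 4 * G * real J" by (simp add: mult_ac)
  finally show ?thesis unfolding V_def G_def .
qed

text \<open>
  Here the dimension is critical: the number \<open>(L / r)^4\<close> of functionals, the weight
  \<open>r powr (2 - 2 * \<nu>)\<close> and the gap \<open>r powr (2 * \<nu> + 2)\<close> multiply to \<open>L^4\<close> at every scale.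
\<close>
lemma multiscale_gap:
  fixes a :: "nat \<Rightarrow> real"
  assumes gap: "\<And>r. 0 < r \<Longrightarrow> r \<le> 1 \<Longrightarrow>
     (\<Sum>k\<le>p. \<Sum>l\<le>p. a k * a l * (matern_mix \<nu> A1 ((r * (real k - real l))\<^sup>2) - matern_mix \<nu> A2 ((r * (real k - real l))\<^sup>2)))
       \<ge> \<delta> * r powr (2 * \<nu> + 2)"
    and L: "0 < L" "L \<le> 1"
  shows "(\<Sum>i\<in>multiscale_index p J. scale_weight \<nu> L i * (\<Sum>k\<le>p. \<Sum>l\<le>p. a k * a l *
      (matern_mix \<nu> A1 ((norm (stencil_point x0 L i l - stencil_point x0 L i k))\<^sup>2)
       - matern_mix \<nu> A2 ((norm (stencil_point x0 L i l - stencil_point x0 L i k))\<^sup>2))))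
    \<ge> \<delta> * L ^ 4 * real J"
proof -
  have d: "(norm (stencil_point x0 L (j, i) l - stencil_point x0 L (j, i) k))\<^sup>2 = (grid_spacing L j * (real k - real l))\<^sup>2"
    for j i k l
  proof -
    have "stencil_point x0 L (j, i) l - stencil_point x0 L (j, i) k = (grid_spacing L j * (real l - real k)) *\<^sub>R axis 1 1"
      by (simp add: stencil_point_def right_diff_distrib scaleR_diff_left)
    then have "norm (stencil_point x0 L (j, i) l - stencil_point x0 L (j, i) k) = \<bar>grid_spacing L j * (real l - real k)\<bar>"
      by (simp only: norm_scaleR norm_axis_1 mult_1_right)
    then show ?thesis by (simp add: power_mult_distrib power2_commute)
  qed
  have r: "0 < grid_spacing L j" "grid_spacing L j \<le> 1" for j
    using L by (auto simp: grid_spacing_def divide_le_eq intro: order_trans[OF _ one_le_power])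
  have scale: "(2 ^ j) ^ 4 * (grid_spacing L j powr (2 - 2 * \<nu>) * (\<delta> * grid_spacing L j powr (2 * \<nu> + 2))) = \<delta> * L ^ 4" for j
  proof -
    have "grid_spacing L j powr (2 - 2 * \<nu>) * grid_spacing L j powr (2 * \<nu> + 2) = grid_spacing L j powr 4"
      by (simp flip: powr_add)
    also have "\<dots> = L ^ 4 / (2 ^ j) ^ 4"
      using r[of j] by (simp add: powr_numeral) (simp add: grid_spacing_def power_divide)
    finally show ?thesis by (simp add: field_simps)
  qed
  have "\<delta> * L ^ 4 * real J = (\<Sum>j\<in>{p..<p+J}. \<Sum>i\<in>(cube_grid (2 ^ j) :: (4 \<Rightarrow> nat) set).
      grid_spacing L j powr (2 - 2 * \<nu>) * (\<delta> * grid_spacing L j powr (2 * \<nu> + 2)))"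
    by (simp add: card_cube_grid scale)
  also have "\<dots> \<le> (\<Sum>j\<in>{p..<p+J}. \<Sum>i\<in>(cube_grid (2 ^ j) :: (4 \<Rightarrow> nat) set).
      grid_spacing L j powr (2 - 2 * \<nu>) * (\<Sum>k\<le>p. \<Sum>l\<le>p. a k * a l *
       (matern_mix \<nu> A1 ((grid_spacing L j * (real k - real l))\<^sup>2) - matern_mix \<nu> A2 ((grid_spacing L j * (real k - real l))\<^sup>2))))"
    by (intro sum_mono mult_left_mono gap r) auto
  also have "\<dots> = (\<Sum>i\<in>multiscale_index p J. scale_weight \<nu> L i * (\<Sum>k\<le>p. \<Sum>l\<le>p. a k * a l *
      (matern_mix \<nu> A1 ((norm (stencil_point x0 L i l - stencil_point x0 L i k))\<^sup>2)
       - matern_mix \<nu> A2 ((norm (stencil_point x0 L i l - stencil_point x0 L i k))\<^sup>2))))"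
    unfolding sum_multiscale_index by (simp add: scale_weight_def d)
  finally show ?thesis .
qed

lemma matern_field_centered_gaussian:
  assumes "matern_field M Y \<sigma> \<alpha> \<nu>" "\<nu> > 0" "\<alpha> > 0" "\<sigma> > 0"
  shows "centered_gaussian_field M Y"
    and "(\<integral>\<omega>. Y s \<omega> * Y t \<omega> \<partial>M) = \<sigma>\<^sup>2 * \<alpha> powr (2 * \<nu>) / Gamma \<nu> * matern_mix \<nu> (\<alpha>\<^sup>2) ((norm (t - s))\<^sup>2)"
proof -
  show cg: "centered_gaussian_field M Y"
    using assms(1) by unfold_locales (auto simp: matern_field_def)
  show "(\<integral>\<omega>. Y s \<omega> * Y t \<omega> \<partial>M) = \<sigma>\<^sup>2 * \<alpha> powr (2 * \<nu>) / Gamma \<nu> * matern_mix \<nu> (\<alpha>\<^sup>2) ((norm (t - s))\<^sup>2)"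
    using assms centered_gaussian_field.covariance_eq[OF cg, of s t] matern_cov_eq_mix[of \<nu> \<alpha> \<sigma> "t - s"]
    by (simp add: matern_field_def)
qed

text \<open>
  The order of \<open>\<alpha>1\<close> and \<open>\<alpha>2\<close> fixes the sign of the variance gap; the general case follows by
  symmetry of mutual singularity.
\<close>
lemma matern_path_laws_singular_ordered:
  fixes D :: "(real ^ 4) set"
  assumes nu: "\<nu> > 0" and D: "bounded D" "interior D \<noteq> {}"
    and pos: "\<sigma>1 > 0" "\<alpha>1 > 0" "\<sigma>2 > 0" "\<alpha>2 > 0"
    and Y1: "matern_field M1 Y1 \<sigma>1 \<alpha>1 \<nu>" and Y2: "matern_field M2 Y2 \<sigma>2 \<alpha>2 \<nu>"
    and eq: "\<sigma>1\<^sup>2 * \<alpha>1 powr (2 * \<nu>) = \<sigma>2\<^sup>2 * \<alpha>2 powr (2 * \<nu>)"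
    and less: "\<alpha>1 < \<alpha>2"
    and P1: "is_path_law M1 Y1 (closure D) P1" and P2: "is_path_law M2 Y2 (closure D) P2"
  shows "mutually_singular P1 P2"
proof -
  define \<kappa> where "\<kappa> = \<sigma>1\<^sup>2 * \<alpha>1 powr (2 * \<nu>) / Gamma \<nu>"
  have \<kappa>: "\<kappa> > 0" using nu pos Gamma_real_pos[OF nu] by (simp add: \<kappa>_def)
  note cg1 = matern_field_centered_gaussian[OF Y1 nu pos(2) pos(1)]
  note cg2 = matern_field_centered_gaussian[OF Y2 nu pos(4) pos(3)]
  interpret F1: centered_gaussian_field M1 Y1 by (rule cg1)
  interpret F2: centered_gaussian_field M2 Y2 by (rule cg2)
  have cov1: "(\<integral>\<omega>. Y1 s \<omega> * Y1 t \<omega> \<partial>M1) = \<kappa> * matern_mix \<nu> (\<alpha>1\<^sup>2) ((norm (t - s))\<^sup>2)" for s t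
    using cg1(2) by (simp add: \<kappa>_def)
  have cov2: "(\<integral>\<omega>. Y2 s \<omega> * Y2 t \<omega> \<partial>M2) = \<kappa> * matern_mix \<nu> (\<alpha>2\<^sup>2) ((norm (t - s))\<^sup>2)" for s t
    using cg2(2) eq by (simp add: \<kappa>_def)
  obtain m :: nat where m: "real m > \<nu>" using reals_Archimedean2 by blast
  \<comment> \<open>the order of the stencil that leaves a factor \<open>1 / (1 + u) ^ m\<close> with \<open>m > \<nu>\<close> in dimension four\<close>
  define p where "p = 2 * m + 4"
  obtain a :: "nat \<Rightarrow> real" and C where a0: "a 0 \<noteq> 0" and C: "C > 0" and
    st: "\<And>A r (x :: real ^ 4). A > 0 \<Longrightarrow> r > 0 \<Longrightarrow>
        (\<Sum>k\<le>p. a k * matern_mix \<nu> A ((norm (x + (r * real k) *\<^sub>R axis 1 1))\<^sup>2))\<^sup>2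
        \<le> C * r powr (4 * \<nu>) * lattice_weight (x /\<^sub>R r)"
    using matern_mix_stencil_bound[OF nu m, of "1 :: 4"] by (auto simp: p_def)
  obtain B where B: "B > 0" and
    lw: "\<And>(y :: real ^ 4) n. (\<Sum>i\<in>cube_grid n. lattice_weight (y + (\<chi> c. real (i c)))) \<le> B"
    using lattice_weight_sum_bound by blast
  have A: "0 < \<alpha>1\<^sup>2" "0 < \<alpha>2\<^sup>2" "\<alpha>1\<^sup>2 < \<alpha>2\<^sup>2" using pos less by (auto intro: power_strict_mono)
  obtain \<delta> where \<delta>: "\<delta> > 0" and
    gap: "\<And>r. 0 < r \<Longrightarrow> r \<le> 1 \<Longrightarrow>
     (\<Sum>k\<le>p. \<Sum>l\<le>p. a k * a l * (matern_mix \<nu> (\<alpha>1\<^sup>2) ((r * (real k - real l))\<^sup>2) - matern_mix \<nu> (\<alpha>2\<^sup>2) ((r * (real k - real l))\<^sup>2)))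
       \<ge> \<delta> * r powr (2 * \<nu> + 2)"
    using matern_mix_stencil_gap[where a = a and p = p, OF nu A(1,3) a0] by blast
  obtain x0 L where L: "0 < L" "L \<le> 1" and
    cube: "\<And>y. (\<forall>c. 0 \<le> (y - x0) $ c \<and> (y - x0) $ c \<le> 2 * L) \<Longrightarrow> y \<in> D"
    using interior_contains_cube[OF D(2)] by blast
  define H where "H = \<kappa>\<^sup>2 * (4 * L ^ 4 * ((\<Sum>k\<le>p. (a k)\<^sup>2) * (real p + 1) * C * B))"
  let ?pt = "stencil_point x0 L"
  have var: "(\<Sum>i\<in>multiscale_index p J. \<Sum>j\<in>multiscale_index p J. scale_weight \<nu> L i * scale_weight \<nu> L j *
      (\<Sum>k\<le>p. \<Sum>l\<le>p. a k * a l * (\<kappa> * matern_mix \<nu> A ((norm (?pt j l - ?pt i k))\<^sup>2)))\<^sup>2) \<le> H * real J"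
    if "A > 0" for A J
  proof -
    have "(\<Sum>k\<le>p. \<Sum>l\<le>p. a k * a l * (\<kappa> * matern_mix \<nu> A ((norm (?pt j l - ?pt i k))\<^sup>2)))\<^sup>2
      = \<kappa>\<^sup>2 * (\<Sum>k\<le>p. \<Sum>l\<le>p. a k * a l * matern_mix \<nu> A ((norm (?pt j l - ?pt i k))\<^sup>2))\<^sup>2" for i j
      by (simp add: power_mult_distrib[symmetric] sum_distrib_left mult_ac)
    then have "(\<Sum>i\<in>multiscale_index p J. \<Sum>j\<in>multiscale_index p J. scale_weight \<nu> L i * scale_weight \<nu> L j *
      (\<Sum>k\<le>p. \<Sum>l\<le>p. a k * a l * (\<kappa> * matern_mix \<nu> A ((norm (?pt j l - ?pt i k))\<^sup>2)))\<^sup>2)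
     = \<kappa>\<^sup>2 * (\<Sum>i\<in>multiscale_index p J. \<Sum>j\<in>multiscale_index p J. scale_weight \<nu> L i * scale_weight \<nu> L j *
      (\<Sum>k\<le>p. \<Sum>l\<le>p. a k * a l * matern_mix \<nu> A ((norm (?pt j l - ?pt i k))\<^sup>2))\<^sup>2)"
      by (simp add: sum_distrib_left mult.left_commute)
    also have "\<dots> \<le> \<kappa>\<^sup>2 * (4 * L ^ 4 * ((\<Sum>k\<le>p. (a k)\<^sup>2) * (real p + 1) * C * B) * real J)"
      by (intro mult_left_mono multiscale_covariance_sum_bound st lw C B that nu L) auto
    finally show ?thesis by (simp add: H_def mult.assoc)
  qed
  have K: "compact (closure D)" using D(1) by (simp add: compact_closure)
  have sq1: "(\<integral>\<omega>. (\<Sum>k\<le>p. a k * Y1 (?pt i k) \<omega>)\<^sup>2 \<partial>M1) = (\<Sum>k\<le>p. \<Sum>l\<le>p. a k * a l * (\<kappa> * matern_mix \<nu> (\<alpha>1\<^sup>2) ((norm (?pt i l - ?pt i k))\<^sup>2)))" for i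
    unfolding power2_eq_square[of "sum _ _"] F1.stencil_product_expectation cov1 ..
  have sq2: "(\<integral>\<omega>. (\<Sum>k\<le>p. a k * Y2 (?pt i k) \<omega>)\<^sup>2 \<partial>M2) = (\<Sum>k\<le>p. \<Sum>l\<le>p. a k * a l * (\<kappa> * matern_mix \<nu> (\<alpha>2\<^sup>2) ((norm (?pt i l - ?pt i k))\<^sup>2)))" for i
    unfolding power2_eq_square[of "sum _ _"] F2.stencil_product_expectation cov2 ..
  show ?thesis
  proof (rule path_laws_singular_if_quad_forms_separate[OF cg1(1) cg2(1) P1 P2 K,
        where I = "multiscale_index p" and p = p and a = a and pt = ?pt and w = "scale_weight \<nu> L"
          and h = "\<kappa> * (\<delta> * L ^ 4)" and H = H])
    show "finite (multiscale_index p J)" for J by (rule finite_multiscale_index)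
    show "?pt i k \<in> closure D" if "i \<in> multiscale_index p J" "k \<le> p" for J i k
      using cube[of "?pt i k"] stencil_point_in_cube[OF L(1) that] closure_subset by blast
    show "\<kappa> * (\<delta> * L ^ 4) > 0" using \<kappa> \<delta> L by simp
    show "(\<Sum>i\<in>multiscale_index p J. scale_weight \<nu> L i * (\<integral>\<omega>. (\<Sum>k\<le>p. a k * Y1 (?pt i k) \<omega>)\<^sup>2 \<partial>M1))
        - (\<Sum>i\<in>multiscale_index p J. scale_weight \<nu> L i * (\<integral>\<omega>. (\<Sum>k\<le>p. a k * Y2 (?pt i k) \<omega>)\<^sup>2 \<partial>M2))
        \<ge> \<kappa> * (\<delta> * L ^ 4) * real J" for J
    proof -
      have "\<kappa> * (\<delta> * L ^ 4) * real J \<le> \<kappa> * (\<Sum>i\<in>multiscale_index p J. scale_weight \<nu> L i * (\<Sum>k\<le>p. \<Sum>l\<le>p. a k * a l *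
      (matern_mix \<nu> (\<alpha>1\<^sup>2) ((norm (?pt i l - ?pt i k))\<^sup>2) - matern_mix \<nu> (\<alpha>2\<^sup>2) ((norm (?pt i l - ?pt i k))\<^sup>2))))"
        unfolding mult.assoc[of \<kappa>] using \<kappa> by (intro mult_left_mono multiscale_gap gap L) auto
      also have "\<dots> = (\<Sum>i\<in>multiscale_index p J. scale_weight \<nu> L i * (\<integral>\<omega>. (\<Sum>k\<le>p. a k * Y1 (?pt i k) \<omega>)\<^sup>2 \<partial>M1))
        - (\<Sum>i\<in>multiscale_index p J. scale_weight \<nu> L i * (\<integral>\<omega>. (\<Sum>k\<le>p. a k * Y2 (?pt i k) \<omega>)\<^sup>2 \<partial>M2))"
        unfolding sq1 sq2
        by (simp add: sum_distrib_left sum_subtractf[symmetric] right_diff_distrib mult_ac)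
      finally show ?thesis .
    qed
    show "(\<Sum>i\<in>multiscale_index p J. \<Sum>j\<in>multiscale_index p J. scale_weight \<nu> L i * scale_weight \<nu> L j *
      (\<integral>\<omega>. (\<Sum>k\<le>p. a k * Y1 (?pt i k) \<omega>) * (\<Sum>k\<le>p. a k * Y1 (?pt j k) \<omega>) \<partial>M1)\<^sup>2) \<le> H * real J" for J
      unfolding F1.stencil_product_expectation cov1 by (rule var[OF A(1)])
    show "(\<Sum>i\<in>multiscale_index p J. \<Sum>j\<in>multiscale_index p J. scale_weight \<nu> L i * scale_weight \<nu> L j *
      (\<integral>\<omega>. (\<Sum>k\<le>p. a k * Y2 (?pt i k) \<omega>) * (\<Sum>k\<le>p. a k * Y2 (?pt j k) \<omega>) \<partial>M2)\<^sup>2) \<le> H * real J" for J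
      unfolding F2.stencil_product_expectation cov2 by (rule var[OF A(2)])
  qed
qed

theorem theorem2:
  fixes D :: "(real ^ 4) set"
    and \<nu> \<sigma>1 \<sigma>2 \<alpha>1 \<alpha>2 :: real
    and M1 :: "'w1 measure" and M2 :: "'w2 measure"
    and Y1 :: "real ^ 4 \<Rightarrow> 'w1 \<Rightarrow> real" and Y2 :: "real ^ 4 \<Rightarrow> 'w2 \<Rightarrow> real"
    and P1 P2 :: "(real ^ 4 \<Rightarrow> real) measure"
  assumes "\<nu> > 0"
    and "bounded D" and "connected D" and "interior D \<noteq> {}"
    and "\<sigma>1 > 0" and "\<alpha>1 > 0" and "\<sigma>2 > 0" and "\<alpha>2 > 0"
    and "matern_field M1 Y1 \<sigma>1 \<alpha>1 \<nu>"
    and "matern_field M2 Y2 \<sigma>2 \<alpha>2 \<nu>"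
    and "\<sigma>1\<^sup>2 * \<alpha>1 powr (2 * \<nu>) = \<sigma>2\<^sup>2 * \<alpha>2 powr (2 * \<nu>)"
    and "\<alpha>1 \<noteq> \<alpha>2"
    and "is_path_law M1 Y1 (closure D) P1"
    and "is_path_law M2 Y2 (closure D) P2"
  shows "mutually_singular P1 P2"
proof (cases "\<alpha>1 < \<alpha>2")
  case True
  show ?thesis
    by (rule matern_path_laws_singular_ordered[OF assms(1,2,4-11) True assms(13,14)])
next
  case False
  then have less: "\<alpha>2 < \<alpha>1" using assms(12) by simp
  have "mutually_singular P2 P1"
    by (rule matern_path_laws_singular_ordered[OF assms(1,2,4,7,8,5,6,10,9) assms(11)[symmetric] less assms(14,13)])
  moreover have "prob_space M1" "prob_space M2"
    using assms(9,10) by (auto simp: matern_field_def gaussian_field_def)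
  then have "sets P2 = sets P1"
    using is_path_law_prob_space(2) assms(13,14) by metis
  ultimately show ?thesis by (rule mutually_singular_sym)
qed

end
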